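(* For all integers $l,m\ge0$, as formal power series in $t_1,\dots,t_l,u_1,\dots,u_m,v$, $$\sum_{n\ge0,\ \lambda\ge0,\ \mu\ge0}\langle H_\lambda E_\mu\rangle_n\,t^\lambda u^\mu v^n=\prod_{R\sqsubset[l]}\frac{\prod_{S\subset[m],\ |S|\text{ odd}}(1+u^St^Rv)}{\prod_{S\subset[m],\ |S|\text{ even}}(1-u^St^Rv)}.$$
   Context: Let $K$ be a field of characteristic $0$ and $P=K[X_1,X_2,\dots]$. For $w\in S_n$ let $X_i(w)$ be the number of $i$-cycles of $w$. For $q\in P$, $\langle q\rangle_n=\frac1{n!}\sum_{w\in S_n}q(X_1(w),X_2(w),\dots)$. Define $H_d,E_d\in P$ ($d\ge0$) by $\sum_{d\ge0}H_dt^d=\prod_{i\ge1}(1-t^i)^{-X_i}$ and $\sum_{d\ge0}E_dt^d=\prod_{i\ge1}(1-(-t)^i)^{X_i}$ in $P[[t]]$ (powers expanded by the binomial series). The sum is over all vectors $\lambda=(\lambda_1,\dots,\lambda_l)$ and $\mu=(\mu_1,\dots,\mu_m)$ with non-negative integer entries; $H_\lambda=H_{\lambda_1}\cdots H_{\lambda_l}$, $E_\mu=E_{\mu_1}\cdots E_{\mu_m}$, $t^\lambda=t_1^{\lambda_1}\cdots t_l^{\lambda_l}$, $u^\mu=u_1^{\mu_1}\cdots u_m^{\mu_m}$. $R\sqsubset[l]$ means that $R$ is a finite multiset (possibly empty) with elements drawn from $[l]=\{1,\dots,l\}$; $t^R$ is the monomial in which $t_i$ is raised to the multiplicity of $i$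 in $R$. For a subset $S\subset[m]$ (possibly empty), $u^S=\prod_{i\in S}u_i$. *)

theory Defs
  imports
    "HOL-Analysis.Analysis"
    "HOL-Library.Poly_Mapping"
    "HOL-Library.Multiset"
    "HOL-Computational_Algebra.Formal_Power_Series"
    "HOL-Combinatorics.Orbits"
begin

section \<open>Character polynomials\<close>

text \<open>
  The polynomial ring \<open>P = K[X\<^sub>1, X\<^sub>2, \<dots>]\<close>. A monomial is a finitely supported exponent
  function; since \<^typ>\<open>nat\<close> starts at 0, the index \<open>j\<close> stands for the variable \<open>X\<^bsub>j+1\<^esub>\<close>.
\<close>
type_synonym 'k charpoly = "(nat \<Rightarrow>\<^sub>0 nat) \<Rightarrow>\<^sub>0 'k"

definition cp_const :: "'k::comm_semiring_1 \<Rightarrow> 'k charpoly" where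
  "cp_const c = Poly_Mapping.single 0 c"

text \<open>The variable \<open>X\<^sub>i\<close>, meaningful for \<open>i \<ge> 1\<close>.\<close>
definition cp_X :: "nat \<Rightarrow> 'k::comm_semiring_1 charpoly" where
  "cp_X i = Poly_Mapping.single (Poly_Mapping.single (i - 1) 1) 1"

text \<open>Evaluation of a polynomial at \<open>X\<^sub>i := x i\<close> (\<open>i \<ge> 1\<close>).\<close>
definition cp_eval :: "(nat \<Rightarrow> 'k::comm_semiring_1) \<Rightarrow> 'k charpoly \<Rightarrow> 'k" where
  "cp_eval x q = (\<Sum>a\<in>Poly_Mapping.keys q. Poly_Mapping.lookup q a *
     (\<Prod>j\<in>Poly_Mapping.keys a. x (Suc j) ^ Poly_Mapping.lookup a j))"

text \<open>The cycles of a permutation of \<open>{1..n}\<close> are its orbits; fixed points are 1-cycles.\<close>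
definition num_cycles :: "nat \<Rightarrow> (nat \<Rightarrow> nat) \<Rightarrow> nat \<Rightarrow> nat" where
  "num_cycles n w i = card {C. \<exists>x\<in>{1..n}. C = orbit w x \<and> card C = i}"

definition cp_avg :: "nat \<Rightarrow> 'k::field_char_0 charpoly \<Rightarrow> 'k" where
  "cp_avg n q = 1 / fact n *
     (\<Sum>w | w permutes {1..n}. cp_eval (\<lambda>i. of_nat (num_cycles n w i)) q)"

text \<open>
  The binomial coefficient \<open>a (a - 1) \<cdots> (a - k + 1) / k!\<close> of a polynomial \<open>a\<close>; the library's
  \<^const>\<open>gbinomial\<close> needs a type class with division.
\<close>
definition cp_binom :: "'k::field_char_0 charpoly \<Rightarrow> nat \<Rightarrow> 'k charpoly" where
  "cp_binom a k = cp_const (1 / fact k) * (\<Prod>i<k. a - of_nat i)"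

text \<open>
  The binomial series \<open>f\<^sup>a = \<Sum>\<^sub>k binom(a, k) (f - 1)\<^sup>k\<close>, meaningful if \<open>f\<close> has
  constant term 1.
\<close>
definition fps_cp_power :: "'k::field_char_0 charpoly fps \<Rightarrow> 'k charpoly \<Rightarrow> 'k charpoly fps" where
  "fps_cp_power f a = fps_compose (Abs_fps (cp_binom a)) (f - 1)"

text \<open>In the two infinite products the index \<open>j\<close> runs from 0 and \<open>i = Suc j\<close>.\<close>
definition H :: "nat \<Rightarrow> 'k::field_char_0 charpoly" where
  "H d = fps_nth (prodinf (\<lambda>j. fps_cp_power (1 - fps_X ^ Suc j) (- cp_X (Suc j)))) d"

definition E :: "nat \<Rightarrow> 'k::field_char_0 charpoly" where
  "E d = fps_nth (prodinf (\<lambda>j. fps_cp_power (1 - (- fps_X) ^ Suc j) (cp_X (Suc j)))) d"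

text \<open>
  Both products converge, so that \<^const>\<open>prodinf\<close> is the infinite product in both definitions.
\<close>
lemma fps_has_prodI:
  fixes f :: "nat \<Rightarrow> 'a::comm_ring_1 fps"
  assumes f0: "\<And>j. fps_nth (f j) 0 = 1"
    and f_eq_0: "\<And>j k. 0 < k \<Longrightarrow> k \<le> j \<Longrightarrow> fps_nth (f j) k = 0"
  shows "f has_prod prodinf f"
proof -
  have stable: "fps_nth (\<Prod>i\<le>n. f i) k = fps_nth (\<Prod>i\<le>k. f i) k" if "k \<le> n" for n k
    using that
  proof (induction n rule: dec_induct)
    case (step n)
    have "fps_nth (prod f {..n} * f (Suc n)) k
        = (\<Sum>i\<in>{0..k}. fps_nth (prod f {..n}) i * fps_nth (f (Suc n)) (k - i))"
      by (simp add: fps_mult_nth)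
    also have "\<dots> = (\<Sum>i\<in>{k}. fps_nth (prod f {..n}) i * fps_nth (f (Suc n)) (k - i))"
      using step.hyps by (intro sum.mono_neutral_right) (auto simp: f_eq_0)
    finally show ?case using step.IH by (simp add: f0 mult.commute)
  qed simp
  define p where "p = Abs_fps (\<lambda>k. fps_nth (\<Prod>i\<le>k. f i) k)"
  have "(\<lambda>n. \<Prod>i\<le>n. f i) \<longlonglongrightarrow> p"
  proof (rule tendsto_fpsI)
    fix k show "\<forall>\<^sub>F n in sequentially. fps_nth (\<Prod>i\<le>n. f i) k = fps_nth p k"
      using eventually_ge_at_top[of k]
      by eventually_elim (metis stable p_def fps_nth_Abs_fps)
  qed
  moreover have "fps_nth p 0 = 1"
    by (simp add: p_def f0)
  then have "p \<noteq> 0" by auto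
  ultimately have p: "raw_has_prod f 0 p"
    by (simp add: raw_has_prod_def)
  have nz: "f j \<noteq> 0" for j
    using f0[of j] by auto
  have "prodinf f = p"
    unfolding prodinf_def
  proof (rule the_equality)
    show "f has_prod p" using p by (simp add: has_prod_def)
    fix q assume "f has_prod q"
    with nz have "raw_has_prod f 0 q" by (simp add: has_prod_def)
    with p show "q = p" unfolding raw_has_prod_def by (blast intro: LIMSEQ_unique)
  qed
  with p show ?thesis by (simp add: has_prod_def)
qed

lemma fps_cp_power_nth_le:
  assumes "f = 1 + h * fps_X ^ Suc j" "k \<le> j"
  shows "fps_nth (fps_cp_power f a) k = (if k = 0 then 1 else 0)"
proof -
  have "fps_nth ((h * fps_X ^ Suc j) ^ i) k = (if i = 0 \<and> k = 0 then 1 else 0)" for i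
  proof (cases i)
    case (Suc i')
    have "k < Suc j * i" using assms(2) Suc by (simp add: less_Suc_eq_le)
    moreover have "(h * fps_X ^ Suc j) ^ i = h ^ i * fps_X ^ (Suc j * i)"
      by (simp only: power_mult_distrib power_mult)
    ultimately show ?thesis
      using Suc by (simp only: fps_X_power_mult_right_nth) simp
  qed auto
  then have "fps_nth (fps_cp_power f a) k = (\<Sum>i=0..k. cp_binom a i * (if i = 0 \<and> k = 0 then 1 else 0))"
    using assms(1) by (simp only: fps_cp_power_def fps_compose_nth fps_nth_Abs_fps add_diff_cancel_left')
  also have "\<dots> = (if k = 0 then 1 else 0)"
    by (auto simp: cp_binom_def cp_const_def)
  finally show ?thesis .
qed

lemma has_prod_H: "(\<lambda>j. fps_cp_power (1 - fps_X ^ Suc j) (- cp_X (Suc j))) has_prod Abs_fps H"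
proof -
  have eq: "1 - fps_X ^ Suc j = 1 + (- 1 :: 'a charpoly fps) * fps_X ^ Suc j" for j
    by (simp only: mult_minus_left mult_1 diff_conv_add_uminus)
  have *: "Abs_fps H = prodinf (\<lambda>j. fps_cp_power (1 - fps_X ^ Suc j) (- cp_X (Suc j)))"
    by (rule fps_ext) (simp only: H_def fps_nth_Abs_fps)
  show ?thesis
    unfolding *
    by (rule fps_has_prodI) (simp_all only: fps_cp_power_nth_le[OF eq] le0 if_True refl, auto)
qed

lemma has_prod_E: "(\<lambda>j. fps_cp_power (1 - (- fps_X) ^ Suc j) (cp_X (Suc j))) has_prod Abs_fps E"
proof -
  have eq: "1 - (- fps_X) ^ Suc j = 1 + (- ((- 1) ^ Suc j) :: 'a charpoly fps) * fps_X ^ Suc j" for j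
    by (simp only: mult_minus_left diff_conv_add_uminus power_minus[of fps_X])
  have *: "Abs_fps E = prodinf (\<lambda>j. fps_cp_power (1 - (- fps_X) ^ Suc j) (cp_X (Suc j)))"
    by (rule fps_ext) (simp only: E_def fps_nth_Abs_fps)
  show ?thesis
    unfolding *
    by (rule fps_has_prodI) (simp_all only: fps_cp_power_nth_le[OF eq] le0 if_True refl, auto)
qed


section \<open>Multivariate formal power series\<close>

text \<open>
  Power series over \<^typ>\<open>'a\<close> in variables indexed by \<^typ>\<open>'x\<close>: arbitrary families of
  coefficients indexed by the monomials \<^typ>\<open>'x \<Rightarrow>\<^sub>0 nat\<close>.
\<close>
typedef ('x, 'a) mfps = "UNIV :: (('x \<Rightarrow>\<^sub>0 nat) \<Rightarrow> 'a) set"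
  morphisms mfps_coeff Abs_mfps ..

setup_lifting type_definition_mfps

lemma mfps_eq_iff: "f = g \<longleftrightarrow> (\<forall>a. mfps_coeff f a = mfps_coeff g a)"
  by transfer auto

definition splittings :: "('x \<Rightarrow>\<^sub>0 nat) \<Rightarrow> (('x \<Rightarrow>\<^sub>0 nat) \<times> ('x \<Rightarrow>\<^sub>0 nat)) set" where
  "splittings a = {(b, c). b + c = a}"

lemma finite_splittings [simp, intro]: "finite (splittings a)"
proof -
  let ?K = "Poly_Mapping.keys a"
  let ?F = "PiE ?K (\<lambda>x. {..Poly_Mapping.lookup a x})"
  let ?h = "\<lambda>p :: ('a \<Rightarrow>\<^sub>0 nat) \<times> ('a \<Rightarrow>\<^sub>0 nat). restrict (Poly_Mapping.lookup (fst p)) ?K"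
  have fin: "finite ?F"
    by (intro finite_PiE) auto
  have sub: "?h ` splittings a \<subseteq> ?F"
    by (auto simp: splittings_def lookup_add)
  have inj: "inj_on ?h (splittings a)"
  proof (rule inj_onI, clarify)
    fix b c b' c'
    assume bc: "(b, c) \<in> splittings a" "(b', c') \<in> splittings a"
      and eq: "?h (b, c) = ?h (b', c')"
    have "Poly_Mapping.lookup b x = Poly_Mapping.lookup b' x" for x
    proof (cases "x \<in> ?K")
      case True
      then show ?thesis using fun_cong[OF eq, of x] by simp
    next
      case False
      then have "Poly_Mapping.lookup (b + c) x = 0" "Poly_Mapping.lookup (b' + c') x = 0"
        using bc by (auto simp: splittings_def in_keys_iff)
      then show ?thesis by (simp add: lookup_add)
    qed
    then have "b = b'"
      by (intro poly_mapping_eqI) auto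
    with bc show "b = b' \<and> c = c'"
      by (auto simp: splittings_def)
  qed
  show ?thesis
    using finite_subset[OF sub fin] inj by (simp add: finite_image_iff)
qed

instantiation mfps :: (type, comm_ring_1) comm_ring_1
begin

lift_definition zero_mfps :: "('a, 'b) mfps" is "\<lambda>_. 0" .
lift_definition one_mfps :: "('a, 'b) mfps" is "\<lambda>a. if a = 0 then 1 else 0" .
lift_definition plus_mfps :: "('a, 'b) mfps \<Rightarrow> ('a, 'b) mfps \<Rightarrow> ('a, 'b) mfps"
  is "\<lambda>f g a. f a + g a" .
lift_definition minus_mfps :: "('a, 'b) mfps \<Rightarrow> ('a, 'b) mfps \<Rightarrow> ('a, 'b) mfps"
  is "\<lambda>f g a. f a - g a" .
lift_definition uminus_mfps :: "('a, 'b) mfps \<Rightarrow> ('a, 'b) mfps"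
  is "\<lambda>f a. - f a" .
lift_definition times_mfps :: "('a, 'b) mfps \<Rightarrow> ('a, 'b) mfps \<Rightarrow> ('a, 'b) mfps"
  is "\<lambda>f g a. \<Sum>(b, c)\<in>splittings a. f b * g c" .

instance
proof
  fix f g h :: "('a, 'b) mfps"
  show "f + g + h = f + (g + h)" "f + g = g + f" "0 + f = f" "- f + f = 0" "f - g = f + - g"
    by (transfer; simp add: algebra_simps)+
  show "(0 :: ('a, 'b) mfps) \<noteq> 1"
    by transfer (metis zero_neq_one)
  show comm: "f * g = g * f"
  proof (transfer, rule ext)
    fix f g :: "('a \<Rightarrow>\<^sub>0 nat) \<Rightarrow> 'b" and a
    show "(\<Sum>(b, c)\<in>splittings a. f b * g c) = (\<Sum>(b, c)\<in>splittings a. g b * f c)"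
      by (rule sum.reindex_bij_witness[of _ prod.swap prod.swap])
        (auto simp: splittings_def ac_simps)
  qed
  show "1 * f = f"
  proof (transfer, rule ext)
    fix f :: "('a \<Rightarrow>\<^sub>0 nat) \<Rightarrow> 'b" and a
    have "(\<Sum>(b, c)\<in>splittings a. (if b = 0 then 1 else 0) * f c)
        = (\<Sum>(b :: 'a \<Rightarrow>\<^sub>0 nat, c)\<in>{(0, a)}. (if b = 0 then 1 else 0) * f c)"
      by (rule sum.mono_neutral_right[OF finite_splittings])
        (auto simp: splittings_def split: if_splits)
    then show "(\<Sum>(b, c)\<in>splittings a. (if b = 0 then 1 else 0) * f c) = f a" by simp
  qed
  show "(f + g) * h = f * h + g * h"
    by transfer (simp add: sum.distrib case_prod_unfold distrib_right)
  show "f * g * h = f * (g * h)"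
  proof (transfer, rule ext)
    fix f g h :: "('a \<Rightarrow>\<^sub>0 nat) \<Rightarrow> 'b" and a
    have "(\<Sum>(b, c)\<in>splittings a. (\<Sum>(d, e)\<in>splittings b. f d * g e) * h c)
        = (\<Sum>(p, q)\<in>(SIGMA p:splittings a. splittings (fst p)). f (fst q) * g (snd q) * h (snd p))"
      by (subst sum.Sigma[symmetric]) (auto simp: case_prod_unfold sum_distrib_right)
    also have "\<dots> = (\<Sum>(p, q)\<in>(SIGMA p:splittings a. splittings (snd p)).
        f (fst p) * (g (fst q) * h (snd q)))"
      by (rule sum.reindex_bij_witness[of _
          "\<lambda>(p, q). ((fst p + fst q, snd q), (fst p, fst q))"
          "\<lambda>(p, q). ((fst q, snd q + snd p), (snd q, snd p))"])
        (auto simp: splittings_def add.assoc mult.assoc)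
    also have "\<dots> = (\<Sum>(b, c)\<in>splittings a. f b * (\<Sum>(d, e)\<in>splittings c. g d * h e))"
      by (subst sum.Sigma[symmetric]) (auto simp: case_prod_unfold sum_distrib_left)
    finally show "(\<Sum>(b, c)\<in>splittings a. (\<Sum>(d, e)\<in>splittings b. f d * g e) * h c)
        = (\<Sum>(b, c)\<in>splittings a. f b * (\<Sum>(d, e)\<in>splittings c. g d * h e))" .
  qed
qed

end

text \<open>As usual, the inverse of a non-unit is set to 0.\<close>
instantiation mfps :: (type, comm_ring_1) inverse
begin

definition inverse_mfps :: "('a, 'b) mfps \<Rightarrow> ('a, 'b) mfps" where
  "inverse_mfps f = (if f dvd 1 then THE g. f * g = 1 else 0)"

definition divide_mfps :: "('a, 'b) mfps \<Rightarrow> ('a, 'b) mfps \<Rightarrow> ('a, 'b) mfps" where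
  "divide_mfps f g = f * inverse g"

instance ..

end

lemma mfps_mult_inverse:
  fixes f :: "('x, 'a::comm_ring_1) mfps"
  assumes "f dvd 1"
  shows "f * inverse f = 1"
proof -
  from assms obtain g where g: "f * g = 1" by (metis dvdE)
  have "(THE g. f * g = 1) = g"
  proof (rule the_equality)
    show "f * g = 1" by (rule g)
  next
    fix g' assume "f * g' = 1"
    then have "g = g * (f * g')" by simp
    also have "\<dots> = (f * g) * g'" by (simp only: ac_simps)
    finally show "g' = g" using g by simp
  qed
  with assms g show ?thesis by (simp add: inverse_mfps_def)
qed

text \<open>
  The topology of coefficientwise convergence (product of the discrete topologies): a limit
  exists iff every coefficient is eventually constant, see \<open>tendsto_mfps_iff\<close> below.
\<close>
instantiation mfps :: (type, type) topological_space
begin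

definition open_mfps :: "('a, 'b) mfps set \<Rightarrow> bool" where
  "open_mfps U \<longleftrightarrow> (\<forall>f\<in>U. \<exists>M. finite M \<and>
     (\<forall>g. (\<forall>a\<in>M. mfps_coeff g a = mfps_coeff f a) \<longrightarrow> g \<in> U))"

instance
proof
  show "open (UNIV :: ('a, 'b) mfps set)"
    unfolding open_mfps_def by (intro ballI exI[of _ "{}"]) simp
next
  fix S T :: "('a, 'b) mfps set"
  assume S: "open S" and T: "open T"
  show "open (S \<inter> T)"
    unfolding open_mfps_def
  proof
    fix f assume f: "f \<in> S \<inter> T"
    from S f obtain M where M: "finite M" "\<And>g. (\<forall>a\<in>M. mfps_coeff g a = mfps_coeff f a) \<Longrightarrow> g \<in> S"
      unfolding open_mfps_def by blast
    from T f obtain N where N: "finite N" "\<And>g. (\<forall>a\<in>N. mfps_coeff g a = mfps_coeff f a) \<Longrightarrow> g \<in> T"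
      unfolding open_mfps_def by blast
    show "\<exists>M. finite M \<and> (\<forall>g. (\<forall>a\<in>M. mfps_coeff g a = mfps_coeff f a) \<longrightarrow> g \<in> S \<inter> T)"
      by (rule exI[of _ "M \<union> N"]) (use M N in auto)
  qed
next
  fix K :: "('a, 'b) mfps set set"
  assume K: "\<forall>S\<in>K. open S"
  show "open (\<Union>K)"
    unfolding open_mfps_def
  proof
    fix f assume "f \<in> \<Union>K"
    then obtain S where S: "S \<in> K" "f \<in> S" by blast
    with K obtain M where "finite M" "\<And>g. (\<forall>a\<in>M. mfps_coeff g a = mfps_coeff f a) \<Longrightarrow> g \<in> S"
      unfolding open_mfps_def by blast
    with S show "\<exists>M. finite M \<and> (\<forall>g. (\<forall>a\<in>M. mfps_coeff g a = mfps_coeff f a) \<longrightarrow> g \<in> \<Union>K)"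
      by (intro exI[of _ M]) auto
  qed
qed

end

lemma open_mfps_coeff: "open {g :: ('x, 'a) mfps. mfps_coeff g a = c}"
  unfolding open_mfps_def by (intro ballI exI[of _ "{a}"]) auto

instance mfps :: (type, type) t2_space
proof
  fix f g :: "('a, 'b) mfps"
  assume "f \<noteq> g"
  then obtain a where a: "mfps_coeff f a \<noteq> mfps_coeff g a"
    by (auto simp: mfps_eq_iff)
  show "\<exists>U V. open U \<and> open V \<and> f \<in> U \<and> g \<in> V \<and> U \<inter> V = {}"
    by (rule exI[of _ "{h. mfps_coeff h a = mfps_coeff f a}"],
        rule exI[of _ "{h. mfps_coeff h a = mfps_coeff g a}"])
      (use a in \<open>auto simp: open_mfps_coeff\<close>)
qed

lemma tendsto_mfps_iff:
  "(h \<longlongrightarrow> f) F \<longleftrightarrow> (\<forall>a. \<forall>\<^sub>F x in F. mfps_coeff (h x) a = mfps_coeff f a)"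
proof (intro iffI allI)
  fix a assume "(h \<longlongrightarrow> f) F"
  from topological_tendstoD[OF this open_mfps_coeff[of a "mfps_coeff f a"]]
  show "\<forall>\<^sub>F x in F. mfps_coeff (h x) a = mfps_coeff f a" by simp
next
  assume *: "\<forall>a. \<forall>\<^sub>F x in F. mfps_coeff (h x) a = mfps_coeff f a"
  show "(h \<longlongrightarrow> f) F"
  proof (rule topological_tendstoI)
    fix U assume "open U" "f \<in> U"
    then obtain M where M: "finite M" "\<And>g. (\<forall>a\<in>M. mfps_coeff g a = mfps_coeff f a) \<Longrightarrow> g \<in> U"
      unfolding open_mfps_def by blast
    from M(1) * have "\<forall>\<^sub>F x in F. \<forall>a\<in>M. mfps_coeff (h x) a = mfps_coeff f a"
      by (simp add: eventually_ball_finite_distrib)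
    then show "\<forall>\<^sub>F x in F. h x \<in> U"
      by eventually_elim (rule M(2))
  qed
qed

text \<open>The multiplicative analogue of \<^const>\<open>HAS_SUM\<close>.\<close>
definition has_prod_over ::
    "('i \<Rightarrow> 'a::{comm_monoid_mult, topological_space}) \<Rightarrow> 'i set \<Rightarrow> 'a \<Rightarrow> bool" where
  "has_prod_over f A p \<longleftrightarrow> (prod f \<longlongrightarrow> p) (finite_subsets_at_top A)"

lift_definition mfps_const :: "'a::zero \<Rightarrow> ('x, 'a) mfps" is
  "\<lambda>c a. if a = 0 then c else 0" .

lift_definition mfps_var :: "'x \<Rightarrow> ('x, 'a::zero_neq_one) mfps" is
  "\<lambda>x a. if a = Poly_Mapping.single x 1 then 1 else 0" .

text \<open>
  For every \<open>l\<close> and \<open>m\<close>, the ring of power series in \<open>t\<^sub>1, \<dots>, t\<^sub>l, u\<^sub>1, \<dots>, u\<^sub>m, v\<close> is a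
  (topologically embedded) subring of the ring of power series in the following variables.
\<close>
datatype gf_var = T nat | U nat | V

abbreviation t :: "nat \<Rightarrow> (gf_var, 'k::comm_ring_1) mfps" where "t i \<equiv> mfps_var (T i)"
abbreviation u :: "nat \<Rightarrow> (gf_var, 'k::comm_ring_1) mfps" where "u j \<equiv> mfps_var (U j)"
abbreviation v :: "(gf_var, 'k::comm_ring_1) mfps" where "v \<equiv> mfps_var V"

end

theory Submission
  imports Defs
begin

text \<open>
  A permutation enters \<open>\<langle>H\<^sub>\<lambda> E\<^sub>\<mu>\<rangle>\<^sub>n\<close> only through its cycle type, and multiplicatively: evaluated at
  \<open>w\<close>, the defining products become \<open>\<Sum>\<^sub>d H\<^sub>d(w) x\<^sup>d = \<Prod>\<^sub>C (1 - x\<^bsup>|C|\<^esup>)\<^sup>-\<^sup>1\<close> and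
  \<open>\<Sum>\<^sub>d E\<^sub>d(w) x\<^sup>d = \<Prod>\<^sub>C (1 - (-x)\<^bsup>|C|\<^esup>)\<close>, where \<open>C\<close> runs over the cycles of \<open>w\<close>
  (\<open>cp_eval_H\<close>, \<open>cp_eval_E\<close>). Hence the series on the left of the theorem is
  \<open>\<Sum>\<^sub>n (1/n!) \<Sum>\<^sub>w \<Prod>\<^sub>C f(|C|)\<close>, where
  \<open>f(c) = v\<^sup>c \<Prod>\<^sub>i (1 - t\<^sub>i\<^sup>c)\<^sup>-\<^sup>1 \<Prod>\<^sub>j (1 - (-u\<^sub>j)\<^sup>c)\<close>. By the exponential formula this is
  \<open>exp (\<Sum>\<^sub>c f(c)/c)\<close>. Expanding \<open>f(c)\<close> as a sum over \<open>R\<close> and \<open>S\<close> of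
  \<open>\<plusminus>(t\<^sup>R u\<^sup>S v)\<^sup>c\<close> turns the exponent into a sum of logarithms of the factors on the right.

  Exponentials and logarithms are avoided by working with the Euler derivation \<open>D = v d/dv\<close>. A power
  series that is 1 at \<open>v = 0\<close> is determined by its logarithmic derivative \<open>l\<close> through
  \<open>D g = l g\<close>, and, coefficient by coefficient, it depends on \<open>l\<close> continuously
  (\<open>tendsto_if_log_euler_tendsto\<close>). So three facts suffice.

  \<^item> The left side has logarithmic derivative \<open>\<Sum>\<^sub>c f(c)\<close> (\<open>has_log_euler_cycle_gf\<close>). This is the
    recurrence \<open>n A\<^sub>n = \<Sum>\<^sub>c f(c) A\<^bsub>n-c\<^esub>\<close> for the averages \<open>A\<^sub>n\<close>, which one gets by singling out
    the cycle of one element (\<open>cycle_sum_Suc\<close>, \<open>cycle_average_Suc\<close>).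
  \<^item> The factor of \<open>(R, S)\<close> is a univariate series in the monomial \<open>y = u\<^sup>S t\<^sup>R v\<close>. As \<open>D y = y\<close>, its
    logarithmic derivative is \<open>\<Sum>\<^sub>k (-1)\<^bsup>|S|(k+1)\<^esup> y\<^sup>k\<close> with \<open>k \<ge> 1\<close>
    (\<open>factor_log_series\<close>, \<open>has_log_euler_subst\<close>).
  \<^item> The sum of these series over \<open>R\<close> and \<open>S\<close> converges to \<open>\<Sum>\<^sub>c f(c)\<close>: the monomials of \<open>f(c)\<close>
    are the powers \<open>(u\<^sup>S t\<^sup>R v)\<^sup>c\<close>, and a monomial is such a power in at most one way
    (\<open>tendsto_weight_gf\<close>).

  In particular, the infinite product converges because its logarithmic derivatives do.
\<close>

section \<open>Cycle weights of permutations\<close>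

lemma orbit_eq_iff_mem:
  assumes "q permutes A" "finite A"
  shows "orbit q x = orbit q y \<longleftrightarrow> y \<in> orbit q x"
  using assms by (metis cyclic_on_orbit orbit_cyclic_eq3 permutation_permutes permutation_self_in_orbit)

text \<open>
  Composing \<open>q\<close> with the transposition of \<open>a\<close> and \<open>b\<close> inserts the fixed point \<open>a\<close> of \<open>q\<close> into the cycle of
  \<open>b\<close>, immediately before \<open>b\<close>; this lemma and the next two describe the effect on the cycles.
\<close>
lemma orbit_transpose_comp_root:
  assumes q: "q permutes A" and A: "finite A" and b: "b \<in> A" and a: "a \<notin> A"
  shows "orbit (Transposition.transpose a b \<circ> q) a = insert a (orbit q b)"
proof -
  define r where "r = Transposition.transpose a b \<circ> q"
  have sub: "orbit q b \<subseteq> A"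
    using q b by (rule permutes_orbit_subset)
  have bb: "b \<in> orbit q b"
    using q A by (intro permutation_self_in_orbit) (auto simp: permutation_permutes)
  have ra: "r a = b"
    using permutes_not_in[OF q a] by (simp add: r_def)
  have rA: "r y = (if q y = b then a else q y)" if "y \<in> A" for y
    using that a permutes_in_image[OF q, of y] by (auto simp: r_def Transposition.transpose_def)
  have "orbit r a \<subseteq> insert a (orbit q b)"
  proof
    fix y assume "y \<in> orbit r a"
    then show "y \<in> insert a (orbit q b)"
    proof induction
      case base
      then show ?case using ra bb by simp
    next
      case (step y)
      then show ?case
        using ra bb rA[of y] subsetD[OF sub, of y] orbit.step[of y q b] by (cases "y = a") auto
    qed
  qed
  moreover have b_in: "b \<in> orbit r a"
    using orbit.base[of r a] ra by simp
  moreover have "y \<in> orbit r a" if "y \<in> orbit q b" for y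
    using that
  proof induction
    case base
    then show ?case using b_in rA[OF b] orbit.step[OF b_in] by (cases "q b = b") auto
  next
    case (step y)
    then show ?case
      using b_in rA[of y] subsetD[OF sub, of y] orbit.step[OF step.IH] by (cases "q y = b") auto
  qed
  moreover have "a \<in> orbit r a"
  proof -
    have "permutation r"
      unfolding r_def using q A by (intro permutation_compose permutation_swap_id) (auto simp: permutation_permutes)
    then show ?thesis by (rule permutation_self_in_orbit)
  qed
  ultimately show ?thesis unfolding r_def[symmetric] by blast
qed

lemma orbit_transpose_comp_other:
  assumes q: "q permutes A" and A: "finite A" and x: "x \<in> A" and a: "a \<notin> A"
    and b: "b \<notin> orbit q x"
  shows "orbit (Transposition.transpose a b \<circ> q) x = orbit q x"
proof (rule orbit_cong)
  show "x \<in> orbit q x"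
    using q A by (intro permutation_self_in_orbit) (auto simp: permutation_permutes)
next
  fix y assume "y \<in> orbit q x"
  then have "q y \<in> orbit q x" by (rule orbit.step)
  moreover have "orbit q x \<subseteq> A" using q x by (rule permutes_orbit_subset)
  ultimately show "(Transposition.transpose a b \<circ> q) y = q y"
    using a b by (auto simp: Transposition.transpose_def)
qed

lemma orbits_transpose_comp:
  assumes q: "q permutes A" and A: "finite A" and b: "b \<in> A" and a: "a \<notin> A"
  shows "orbit (Transposition.transpose a b \<circ> q) ` insert a A - {orbit (Transposition.transpose a b \<circ> q) a} =
    orbit q ` A - {orbit q b}"
proof -
  let ?r = "Transposition.transpose a b \<circ> q"
  have r: "?r permutes insert a A"
    using q b by (intro permutes_compose[OF permutes_subset[OF q]] permutes_swap_id) auto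
  note memq = orbit_eq_iff_mem[OF q A]
  note memr = orbit_eq_iff_mem[OF r finite.insertI[OF A]]
  have same: "orbit ?r x = orbit ?r a" if "x \<in> A" "b \<in> orbit q x" for x
  proof -
    have "x \<in> orbit q b" using that memq by (metis A q permutation_permutes permutation_self_in_orbit)
    then have "x \<in> orbit ?r a" using orbit_transpose_comp_root[OF assms] by simp
    then show ?thesis using memr by metis
  qed
  have other: "orbit ?r x = orbit q x" "orbit q x \<noteq> orbit q b" "orbit q x \<noteq> orbit ?r a"
    if "x \<in> A" "b \<notin> orbit q x" for x
  proof -
    show "orbit ?r x = orbit q x" by (rule orbit_transpose_comp_other[OF q A that(1) a that(2)])
    show "orbit q x \<noteq> orbit q b" using that(2) memq by blast
    show "orbit q x \<noteq> orbit ?r a"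
      using permutes_orbit_subset[OF q that(1)] a orbit_transpose_comp_root[OF assms] by auto
  qed
  show ?thesis
  proof (intro equalityI subsetI)
    fix C assume "C \<in> orbit ?r ` insert a A - {orbit ?r a}"
    then obtain x where x: "x \<in> A" "C = orbit ?r x" "C \<noteq> orbit ?r a" by auto
    with same have "b \<notin> orbit q x" by blast
    with other x show "C \<in> orbit q ` A - {orbit q b}" by auto
  next
    fix C assume "C \<in> orbit q ` A - {orbit q b}"
    then obtain x where x: "x \<in> A" "C = orbit q x" "C \<noteq> orbit q b" by auto
    with memq have "b \<notin> orbit q x" by blast
    with other[of x] x show "C \<in> orbit ?r ` insert a A - {orbit ?r a}" by auto
  qed
qed

lemma sum_card_orbits:
  assumes w: "w permutes {1..n}"
  shows "(\<Sum>C\<in>orbit w ` {1..n}. card C) = n"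
proof -
  have "\<Union> (orbit w ` {1..n}) = {1..n}"
  proof
    show "\<Union> (orbit w ` {1..n}) \<subseteq> {1..n}"
      using permutes_orbit_subset[OF w] by blast
    have "x \<in> orbit w x" for x
      using w by (intro permutation_self_in_orbit) (auto simp: permutation_permutes)
    then show "{1..n} \<subseteq> \<Union> (orbit w ` {1..n})" by blast
  qed
  moreover have "card (\<Union> (orbit w ` {1..n})) = (\<Sum>C\<in>orbit w ` {1..n}. card C)"
  proof (rule card_Union_disjoint)
    show "pairwise disjnt (orbit w ` {1..n})"
      using orbit_eq_iff_mem[OF w] by (auto simp: pairwise_def disjnt_def) metis+
    show "finite C" if "C \<in> orbit w ` {1..n}" for C
    proof -
      from that have "C \<subseteq> {1..n}" using permutes_orbit_subset[OF w] by blast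
      then show ?thesis by (rule finite_subset) simp
    qed
  qed
  ultimately show ?thesis by simp
qed

definition cycle_sum :: "(nat \<Rightarrow> 'b::comm_semiring_1) \<Rightarrow> 'a set \<Rightarrow> 'b" where
  "cycle_sum f A = (\<Sum>w | w permutes A. \<Prod>C\<in>orbit w ` A. f (card C))"

text \<open>
  The variant of \<^const>\<open>cycle_sum\<close> on \<open>insert a A\<close> in which the cycle through the root \<open>a\<close> has its own
  weight \<open>g\<close>. Letting \<open>g\<close> vary is what makes an induction possible: contracting the root out of its cycle
  shifts \<open>g\<close> by one and leaves \<open>f\<close> alone.
\<close>
definition rooted_cycle_sum ::
    "(nat \<Rightarrow> 'b::comm_semiring_1) \<Rightarrow> (nat \<Rightarrow> 'b) \<Rightarrow> 'a \<Rightarrow> 'a set \<Rightarrow> 'b" where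
  "rooted_cycle_sum g f a A = (\<Sum>w | w permutes insert a A.
     g (card (orbit w a)) * (\<Prod>C\<in>orbit w ` insert a A - {orbit w a}. f (card C)))"

lemma cycle_sum_insert:
  assumes "finite A"
  shows "cycle_sum f (insert a A) = rooted_cycle_sum f f a A"
  unfolding cycle_sum_def rooted_cycle_sum_def
  using assms by (intro sum.cong refl prod.remove) auto

text \<open>
  Either \<open>a\<close> is a fixed point, or it can be contracted out of its cycle; its image \<open>b\<close> is then the root of
  a cycle that is shorter by one.
\<close>
lemma rooted_cycle_sum_rec:
  fixes f g :: "nat \<Rightarrow> 'b::comm_semiring_1"
  assumes A: "finite A" and a: "a \<notin> A"
  shows "rooted_cycle_sum g f a A =
    g 1 * cycle_sum f A + (\<Sum>b\<in>A. rooted_cycle_sum (\<lambda>c. g (Suc c)) f b (A - {b}))"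
proof -
  let ?W = "\<lambda>w. g (card (orbit w a)) * (\<Prod>C\<in>orbit w ` insert a A - {orbit w a}. f (card C))"
  have "rooted_cycle_sum g f a A
      = (\<Sum>b\<in>insert a A. \<Sum>q | q permutes A. ?W (Transposition.transpose a b \<circ> q))"
    unfolding rooted_cycle_sum_def by (rule sum_over_permutations_insert[OF A a])
  also have "\<dots> = (\<Sum>q | q permutes A. ?W q) + (\<Sum>b\<in>A. \<Sum>q | q permutes A. ?W (Transposition.transpose a b \<circ> q))"
    using A a by simp
  also have "(\<Sum>q | q permutes A. ?W q) = g 1 * cycle_sum f A"
    unfolding cycle_sum_def sum_distrib_left
  proof (rule sum.cong[OF refl])
    fix q assume "q \<in> {q. q permutes A}"
    then have q: "q permutes A" by simp
    have orb: "orbit q a = {a}"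
      using permutes_not_in[OF q a] by (simp add: orbit_eq_singleton_iff)
    have "orbit q ` insert a A - {orbit q a} = orbit q ` A"
      using permutes_orbit_subset[OF q] a orb by auto
    with orb show "?W q = g 1 * (\<Prod>C\<in>orbit q ` A. f (card C))" by simp
  qed
  also have "(\<Sum>b\<in>A. \<Sum>q | q permutes A. ?W (Transposition.transpose a b \<circ> q))
      = (\<Sum>b\<in>A. rooted_cycle_sum (\<lambda>c. g (Suc c)) f b (A - {b}))"
    unfolding rooted_cycle_sum_def
  proof (intro sum.cong refl)
    fix b q assume b: "b \<in> A" and "q \<in> {w. w permutes insert b (A - {b})}"
    then have q: "q permutes A" by (simp add: insert_absorb)
    have sub: "orbit q b \<subseteq> A" by (rule permutes_orbit_subset[OF q b])
    have "card (orbit (Transposition.transpose a b \<circ> q) a) = Suc (card (orbit q b))"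
      unfolding orbit_transpose_comp_root[OF q A b a]
      using sub a finite_subset[OF sub A] by (intro card_insert_disjoint) auto
    moreover have "orbit (Transposition.transpose a b \<circ> q) ` insert a A - {orbit (Transposition.transpose a b \<circ> q) a}
        = orbit q ` insert b (A - {b}) - {orbit q b}"
      using orbits_transpose_comp[OF q A b a] b by (simp add: insert_absorb)
    ultimately show "?W (Transposition.transpose a b \<circ> q) = g (Suc (card (orbit q b))) *
        (\<Prod>C\<in>orbit q ` insert b (A - {b}) - {orbit q b}. f (card C))"
      by simp
  qed (auto simp: insert_absorb)
  finally show ?thesis .
qed

text \<open>
  The summand of index \<open>c\<close> belongs to the permutations whose root lies on a cycle with \<open>c\<close> other elements.
  These can be chosen in \<open>card A choose c\<close> ways and arranged in \<open>fact c\<close> ways. Iterating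
  \<open>rooted_cycle_sum_rec\<close> gives this count without any enumeration of cyclic permutations.
\<close>
lemma rooted_cycle_sum_eq:
  fixes f g :: "nat \<Rightarrow> 'b::comm_semiring_1" and A :: "nat set"
  assumes "finite A" "a \<notin> A"
  shows "rooted_cycle_sum g f a A = (\<Sum>c\<le>card A. of_nat (fact c * (card A choose c)) *
           g (Suc c) * cycle_sum f {1..card A - c})"
proof -
  have main: "finite A \<Longrightarrow> a \<notin> A \<Longrightarrow> card A = n \<Longrightarrow> cycle_sum f A = cycle_sum f {1..n} \<and>
    rooted_cycle_sum g f a A =
      (\<Sum>c\<le>n. of_nat (fact c * (n choose c)) * g (Suc c) * cycle_sum f {1..n - c})"
      for n a and A :: "nat set" and g :: "nat \<Rightarrow> 'b"
  proof (induction n arbitrary: g a A)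
    case 0
    then show ?case using rooted_cycle_sum_rec[of A a g f] by simp
  next
    case (Suc n)
    \<comment> \<open>Removing one element as root shows that the sum over a set depends only on its cardinality.\<close>
    let ?s = "\<lambda>c. of_nat (fact c * (n choose c)) * f (Suc c) * cycle_sum f {1..n - c}"
    have remove: "cycle_sum f B = (\<Sum>c\<le>n. ?s c)" if "finite B" "card B = Suc n" for B :: "nat set"
    proof -
      from that obtain b where b: "b \<in> B" by fastforce
      with that have "cycle_sum f B = rooted_cycle_sum f f b (B - {b})"
        using cycle_sum_insert[of "B - {b}" f b] by (simp add: insert_absorb)
      also have "\<dots> = (\<Sum>c\<le>n. ?s c)"
        using Suc.IH[of "B - {b}" b f] that b by simp
      finally show ?thesis .
    qed
    have 1: "cycle_sum f A = cycle_sum f {1..Suc n}"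
      using remove[of A] remove[of "{1..Suc n}"] Suc.prems by simp
    have "rooted_cycle_sum g f a A = g 1 * cycle_sum f A + (\<Sum>b\<in>A.
        \<Sum>c\<le>n. of_nat (fact c * (n choose c)) * g (Suc (Suc c)) * cycle_sum f {1..n - c})"
      unfolding rooted_cycle_sum_rec[OF Suc.prems(1,2)]
      using Suc.IH Suc.prems by (intro arg_cong2[of _ _ _ _ "(+)"] refl sum.cong) simp
    also have "\<dots> = g 1 * cycle_sum f A + (\<Sum>c\<le>n. of_nat (Suc n * (fact c * (n choose c))) *
        g (Suc (Suc c)) * cycle_sum f {1..n - c})"
      by (simp only: sum_constant Suc.prems(3) of_nat_mult sum_distrib_left mult.assoc)
    also have "\<dots> = g 1 * cycle_sum f {1..Suc n} + (\<Sum>c\<le>n. of_nat (fact (Suc c) * (Suc n choose Suc c)) *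
        g (Suc (Suc c)) * cycle_sum f {1..n - c})"
    proof -
      have "Suc n * (fact c * (n choose c)) = fact (Suc c) * (Suc n choose Suc c)" for c :: nat
        using arg_cong[OF Suc_times_binomial[of c n], of "\<lambda>k. fact c * k"]
        by (simp only: fact_Suc of_nat_id ac_simps)
      with 1 show ?thesis by (simp only:)
    qed
    also have "\<dots> = (\<Sum>c\<le>Suc n. of_nat (fact c * (Suc n choose c)) * g (Suc c) * cycle_sum f {1..Suc n - c})"
      by (subst sum.atMost_Suc_shift) (simp del: binomial_Suc_Suc)
    finally show ?case using 1 by blast
  qed
  from main[OF assms refl] show "rooted_cycle_sum g f a A = (\<Sum>c\<le>card A. of_nat (fact c * (card A choose c)) *
           g (Suc c) * cycle_sum f {1..card A - c})"
    by blast
qed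

lemma cycle_sum_Suc:
  "cycle_sum f {1..Suc n} =
    (\<Sum>c\<le>n. of_nat (fact c * (n choose c)) * f (Suc c) * cycle_sum f {1..n - c})"
  using rooted_cycle_sum_eq[of "{1..n}" "Suc n" f f] cycle_sum_insert[of "{1..n}" f "Suc n"]
  by (simp add: atLeastAtMostSuc_conv)

section \<open>Evaluation of character polynomials at permutations\<close>

definition cp_monom_eval :: "(nat \<Rightarrow> 'k::comm_semiring_1) \<Rightarrow> (nat \<Rightarrow>\<^sub>0 nat) \<Rightarrow> 'k" where
  "cp_monom_eval x a = (\<Prod>j\<in>Poly_Mapping.keys a. x (Suc j) ^ Poly_Mapping.lookup a j)"

lemma cp_monom_eval_superset:
  assumes "finite K" "Poly_Mapping.keys a \<subseteq> K"
  shows "cp_monom_eval x a = (\<Prod>j\<in>K. x (Suc j) ^ Poly_Mapping.lookup a j)"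
  unfolding cp_monom_eval_def
  using assms by (intro prod.mono_neutral_left) (auto simp: in_keys_iff)

lemma cp_monom_eval_add: "cp_monom_eval x (a + b) = cp_monom_eval x a * cp_monom_eval x b"
proof -
  let ?K = "Poly_Mapping.keys a \<union> Poly_Mapping.keys b"
  have "cp_monom_eval x c = (\<Prod>j\<in>?K. x (Suc j) ^ Poly_Mapping.lookup c j)"
    if "c \<in> {a, b, a + b}" for c
    using that Poly_Mapping.keys_add[of a b] by (intro cp_monom_eval_superset) auto
  then show ?thesis
    by (simp add: lookup_add power_add prod.distrib)
qed

lemma cp_eval_superset:
  assumes "finite K" "Poly_Mapping.keys q \<subseteq> K"
  shows "cp_eval x q = (\<Sum>a\<in>K. Poly_Mapping.lookup q a * cp_monom_eval x a)"
  unfolding cp_eval_def cp_monom_eval_def[symmetric]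
  using assms by (intro sum.mono_neutral_left) (auto simp: in_keys_iff)

lemma cp_eval_single: "cp_eval x (Poly_Mapping.single a c) = c * cp_monom_eval x a"
  by (subst cp_eval_superset[of "{a}"]) auto

lemma cp_eval_add: "cp_eval x (p + q) = cp_eval x p + cp_eval x q"
proof -
  let ?K = "Poly_Mapping.keys p \<union> Poly_Mapping.keys q"
  have "cp_eval x r = (\<Sum>a\<in>?K. Poly_Mapping.lookup r a * cp_monom_eval x a)"
    if "r \<in> {p, q, p + q}" for r
    using that Poly_Mapping.keys_add[of p q] by (intro cp_eval_superset) auto
  then show ?thesis
    by (simp add: lookup_add distrib_right sum.distrib)
qed

lemma cp_eval_0: "cp_eval x 0 = 0"
  by (simp add: cp_eval_def)

lemma cp_eval_sum: "cp_eval x (\<Sum>i\<in>I. f i) = (\<Sum>i\<in>I. cp_eval x (f i))"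
  by (induction I rule: infinite_finite_induct) (simp_all add: cp_eval_0 cp_eval_add)

lemma sum_single_lookup:
  "(\<Sum>a\<in>Poly_Mapping.keys q. Poly_Mapping.single a (Poly_Mapping.lookup q a)) = q"
  by (rule poly_mapping_eqI) (auto simp: lookup_sum lookup_single when_def in_keys_iff)

lemma cp_eval_mult: "cp_eval x (p * q) = cp_eval x p * cp_eval x q"
proof -
  let ?P = "Poly_Mapping.keys p" and ?Q = "Poly_Mapping.keys q"
  have "cp_eval x (p * q) = cp_eval x ((\<Sum>a\<in>?P. Poly_Mapping.single a (Poly_Mapping.lookup p a)) *
      (\<Sum>b\<in>?Q. Poly_Mapping.single b (Poly_Mapping.lookup q b)))"
    by (simp only: sum_single_lookup)
  also have "\<dots> = (\<Sum>a\<in>?P. Poly_Mapping.lookup p a * cp_monom_eval x a) *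
      (\<Sum>b\<in>?Q. Poly_Mapping.lookup q b * cp_monom_eval x b)"
    by (simp add: sum_product mult_single cp_eval_sum cp_eval_single cp_monom_eval_add ac_simps)
  also have "\<dots> = cp_eval x p * cp_eval x q"
    by (simp add: cp_eval_superset[OF finite_keys order_refl])
  finally show ?thesis .
qed

lemma cp_eval_const: "cp_eval x (cp_const c) = c"
  by (simp add: cp_const_def cp_eval_single cp_monom_eval_def)

lemma cp_eval_1: "cp_eval x 1 = 1"
  using cp_eval_const[of x 1] by (simp add: cp_const_def)

lemma cp_eval_X: "cp_eval x (cp_X (Suc j)) = x (Suc j)"
  by (simp add: cp_X_def cp_eval_single cp_monom_eval_def)

lemma cp_eval_diff:
  fixes x :: "nat \<Rightarrow> 'k::comm_ring_1"
  shows "cp_eval x (p - q) = cp_eval x p - cp_eval x q"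
  using cp_eval_add[of x "p - q" q] by simp

lemma cp_eval_uminus:
  fixes x :: "nat \<Rightarrow> 'k::comm_ring_1"
  shows "cp_eval x (- q) = - cp_eval x q"
  using cp_eval_diff[of x 0 q] by (simp add: cp_eval_0)

lemma cp_eval_of_nat: "cp_eval x (of_nat n) = of_nat n"
  by (induction n) (simp_all add: cp_eval_0 cp_eval_1 cp_eval_add)

lemma cp_eval_prod: "cp_eval x (\<Prod>i\<in>I. f i) = (\<Prod>i\<in>I. cp_eval x (f i))"
  by (induction I rule: infinite_finite_induct) (simp_all add: cp_eval_1 cp_eval_mult)

lemma cp_eval_binom: "cp_eval x (cp_binom a k) = cp_eval x a gchoose k"
  by (simp add: cp_binom_def cp_eval_mult cp_eval_const cp_eval_prod cp_eval_diff cp_eval_of_nat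
      gbinomial_prod_rev lessThan_atLeast0)

text \<open>
  Evaluation is a ring homomorphism, and so is its coefficientwise extension to power series. It can thus
  be carried through the infinite products that define \<^const>\<open>H\<close> and \<^const>\<open>E\<close>.
\<close>
definition cp_eval_fps :: "(nat \<Rightarrow> 'k::comm_semiring_1) \<Rightarrow> 'k charpoly fps \<Rightarrow> 'k fps" where
  "cp_eval_fps x f = Abs_fps (\<lambda>d. cp_eval x (fps_nth f d))"

lemma cp_eval_fps_nth [simp]: "fps_nth (cp_eval_fps x f) d = cp_eval x (fps_nth f d)"
  by (simp add: cp_eval_fps_def)

lemma cp_eval_fps_mult: "cp_eval_fps x (f * g) = cp_eval_fps x f * cp_eval_fps x g"
  by (rule fps_ext) (simp add: fps_mult_nth cp_eval_sum cp_eval_mult)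

lemma cp_eval_fps_1: "cp_eval_fps x 1 = 1"
  by (rule fps_ext) (simp add: cp_eval_0 cp_eval_1)

lemma cp_eval_fps_X: "cp_eval_fps x fps_X = fps_X"
  by (rule fps_ext) (simp add: cp_eval_0 cp_eval_1 fps_X_def)

lemma cp_eval_fps_diff:
  fixes x :: "nat \<Rightarrow> 'k::comm_ring_1"
  shows "cp_eval_fps x (f - g) = cp_eval_fps x f - cp_eval_fps x g"
  by (rule fps_ext) (simp add: cp_eval_diff)

lemma cp_eval_fps_uminus:
  fixes x :: "nat \<Rightarrow> 'k::comm_ring_1"
  shows "cp_eval_fps x (- f) = - cp_eval_fps x f"
  by (rule fps_ext) (simp add: cp_eval_uminus)

lemma cp_eval_fps_power: "cp_eval_fps x (f ^ k) = cp_eval_fps x f ^ k"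
  by (induction k) (simp_all add: cp_eval_fps_1 cp_eval_fps_mult)

lemma cp_eval_fps_prod: "cp_eval_fps x (\<Prod>i\<in>I. f i) = (\<Prod>i\<in>I. cp_eval_fps x (f i))"
  by (induction I rule: infinite_finite_induct) (simp_all add: cp_eval_fps_1 cp_eval_fps_mult)

lemma cp_eval_fps_cp_power:
  "cp_eval_fps x (fps_cp_power f a) = fps_compose (fps_binomial (cp_eval x a)) (cp_eval_fps x f - 1)"
proof (rule fps_ext)
  fix d
  have "cp_eval x (fps_nth ((f - 1) ^ i) d) = fps_nth ((cp_eval_fps x f - 1) ^ i) d" for i
    by (metis cp_eval_fps_nth cp_eval_fps_power cp_eval_fps_diff cp_eval_fps_1)
  then show "fps_nth (cp_eval_fps x (fps_cp_power f a)) d =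
      fps_nth (fps_compose (fps_binomial (cp_eval x a)) (cp_eval_fps x f - 1)) d"
    by (simp add: fps_cp_power_def fps_compose_nth cp_eval_sum cp_eval_mult cp_eval_binom)
qed

lemma has_prod_imp_tendsto_prod:
  fixes f :: "nat \<Rightarrow> 'a::{t2_space, comm_semiring_1}"
  assumes "f has_prod P" "\<And>j. f j \<noteq> 0"
  shows "(\<lambda>N. \<Prod>j\<le>N. f j) \<longlonglongrightarrow> P"
  using assms by (auto simp: has_prod_def raw_has_prod_def)

text \<open>
  The case of interest is the evaluation at a permutation of \<open>{1..n}\<close>: it has no cycles longer than \<open>n\<close>,
  and so turns all but \<open>n\<close> of the factors into 1.
\<close>
lemma cp_eval_fps_has_prod:
  fixes x :: "nat \<Rightarrow> 'k::comm_ring_1"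
  assumes P: "f has_prod P" and nz: "\<And>j. f j \<noteq> 0"
    and one: "\<And>j. n \<le> j \<Longrightarrow> cp_eval_fps x (f j) = 1"
  shows "cp_eval_fps x P = (\<Prod>j<n. cp_eval_fps x (f j))"
proof (rule fps_ext)
  fix d
  from has_prod_imp_tendsto_prod[OF P nz]
  have "\<forall>\<^sub>F N in sequentially. fps_nth (\<Prod>j\<le>N. f j) d = fps_nth P d"
    unfolding tendsto_fps_iff by blast
  then obtain N where "N \<ge> n" and N: "fps_nth (\<Prod>j\<le>N. f j) d = fps_nth P d"
    using eventually_happens[OF eventually_conj[OF _ eventually_ge_at_top[of n]]] by fastforce
  have "fps_nth (cp_eval_fps x P) d = fps_nth (\<Prod>j\<le>N. cp_eval_fps x (f j)) d"
    by (metis N cp_eval_fps_nth cp_eval_fps_prod)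
  also have "(\<Prod>j\<le>N. cp_eval_fps x (f j)) = (\<Prod>j<n. cp_eval_fps x (f j))"
    using \<open>N \<ge> n\<close> by (intro prod.mono_neutral_right) (auto simp: one)
  finally show "fps_nth (cp_eval_fps x P) d = fps_nth (\<Prod>j<n. cp_eval_fps x (f j)) d" .
qed

lemma prod_num_cycles:
  fixes h :: "nat \<Rightarrow> 'b::comm_monoid_mult"
  assumes "w permutes {1..n}"
  shows "(\<Prod>j<n. h (Suc j) ^ num_cycles n w (Suc j)) = (\<Prod>C\<in>orbit w ` {1..n}. h (card C))"
proof -
  have range: "card C \<in> {1..n}" if "C \<in> orbit w ` {1..n}" for C
  proof -
    from that obtain x where "x \<in> {1..n}" "C = orbit w x" by blast
    then have "C \<noteq> {}" "C \<subseteq> {1..n}"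
      using permutes_orbit_subset[OF assms, of x] orbit_nonempty[of w x] by blast+
    then show ?thesis
      using card_mono[of "{1..n}" C] finite_subset[of C "{1..n}"] by (auto simp: Suc_le_eq card_gt_0_iff)
  qed
  have "(\<Prod>C\<in>orbit w ` {1..n}. h (card C)) =
      (\<Prod>i\<in>{1..n}. \<Prod>C\<in>{C \<in> orbit w ` {1..n}. card C = i}. h (card C))"
    using range by (intro prod.group[symmetric]) auto
  also have "\<dots> = (\<Prod>i\<in>{1..n}. h i ^ num_cycles n w i)"
  proof (rule prod.cong[OF refl])
    fix i
    have "{C \<in> orbit w ` {1..n}. card C = i} = {C. \<exists>x\<in>{1..n}. C = orbit w x \<and> card C = i}"
      by auto
    then show "(\<Prod>C\<in>{C \<in> orbit w ` {1..n}. card C = i}. h (card C)) = h i ^ num_cycles n w i"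
      by (simp add: num_cycles_def)
  qed
  also have "\<dots> = (\<Prod>j<n. h (Suc j) ^ num_cycles n w (Suc j))"
    by (rule prod.reindex_bij_witness[of _ Suc "\<lambda>i. i - 1"]) auto
  finally show ?thesis ..
qed

lemma num_cycles_eq_0:
  assumes "w permutes {1..n}" "n < i"
  shows "num_cycles n w i = 0"
proof -
  have "card (orbit w x) \<le> n" if "x \<in> {1..n}" for x
    using card_mono[OF _ permutes_orbit_subset[OF assms(1) that]] by simp
  with assms(2) have "{C. \<exists>x\<in>{1..n}. C = orbit w x \<and> card C = i} = {}" by fastforce
  then show ?thesis by (simp add: num_cycles_def)
qed

text \<open>
  For exponents \<open>n\<close> and \<open>-n\<close> the binomial series is an ordinary power.
\<close>
lemma fps_compose_binomial_of_nat:
  fixes f :: "'k::field_char_0 fps"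
  assumes "fps_nth f 0 = 1"
  shows "fps_compose (fps_binomial (of_nat n)) (f - 1) = f ^ n"
    and "fps_compose (fps_binomial (- of_nat n)) (f - 1) = inverse f ^ n"
proof -
  have *: "fps_nth (f - 1) 0 = 0" using assms by simp
  show 1: "fps_compose (fps_binomial (of_nat n)) (f - 1) = f ^ n"
    by (simp add: fps_binomial_of_nat fps_compose_power[OF *, symmetric] fps_compose_add_distrib
        fps_X_fps_compose_startby0 assms)
  have "fps_compose (fps_binomial (- of_nat n)) (f - 1) = inverse (fps_compose ((1 + fps_X) ^ n) (f - 1))"
    unfolding fps_binomial_minus_of_nat by (rule fps_inverse_compose[OF *]) simp
  with 1 show "fps_compose (fps_binomial (- of_nat n)) (f - 1) = inverse f ^ n"
    by (simp add: fps_binomial_of_nat fps_inverse_power)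
qed

lemma fps_cp_power_nonzero:
  assumes "f = 1 + h * fps_X ^ Suc j"
  shows "fps_cp_power f a \<noteq> 0"
  using fps_cp_power_nth_le[OF assms le0, of a] by auto

lemma cp_eval_H:
  assumes w: "w permutes {1..n}"
  shows "cp_eval (\<lambda>i. of_nat (num_cycles n w i)) (H d) =
    fps_nth (\<Prod>C\<in>orbit w ` {1..n}. inverse (1 - fps_X ^ card C :: 'k::field_char_0 fps)) d"
proof -
  define x :: "nat \<Rightarrow> 'k" where "x = (\<lambda>i. of_nat (num_cycles n w i))"
  have factor: "cp_eval_fps x (fps_cp_power (1 - fps_X ^ Suc j) (- cp_X (Suc j))) =
      inverse (1 - fps_X ^ Suc j) ^ num_cycles n w (Suc j)" for j
    unfolding cp_eval_fps_cp_power cp_eval_fps_diff cp_eval_fps_1 cp_eval_fps_power cp_eval_fps_X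
      cp_eval_uminus cp_eval_X x_def
    by (rule fps_compose_binomial_of_nat(2)) simp
  have nz: "fps_cp_power (1 - fps_X ^ Suc j) (- cp_X (Suc j)) \<noteq> (0 :: 'k charpoly fps)" for j
    by (rule fps_cp_power_nonzero[of _ "-1" j]) simp
  have "cp_eval_fps x (Abs_fps H) = (\<Prod>j<n. inverse (1 - fps_X ^ Suc j) ^ num_cycles n w (Suc j))"
    unfolding factor[symmetric]
    by (rule cp_eval_fps_has_prod[OF has_prod_H nz]) (unfold factor, simp add: num_cycles_eq_0[OF w])
  also have "\<dots> = (\<Prod>C\<in>orbit w ` {1..n}. inverse (1 - fps_X ^ card C))"
    by (rule prod_num_cycles[OF w])
  finally show ?thesis
    unfolding x_def[symmetric] by (metis cp_eval_fps_nth fps_nth_Abs_fps)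
qed

lemma cp_eval_E:
  assumes w: "w permutes {1..n}"
  shows "cp_eval (\<lambda>i. of_nat (num_cycles n w i)) (E d) =
    fps_nth (\<Prod>C\<in>orbit w ` {1..n}. 1 - (- fps_X) ^ card C :: 'k::field_char_0 fps) d"
proof -
  define x :: "nat \<Rightarrow> 'k" where "x = (\<lambda>i. of_nat (num_cycles n w i))"
  have factor: "cp_eval_fps x (fps_cp_power (1 - (- fps_X) ^ Suc j) (cp_X (Suc j))) =
      (1 - (- fps_X) ^ Suc j) ^ num_cycles n w (Suc j)" for j
    unfolding cp_eval_fps_cp_power cp_eval_fps_diff cp_eval_fps_1 cp_eval_fps_power cp_eval_fps_X
      cp_eval_fps_uminus cp_eval_X x_def
    by (rule fps_compose_binomial_of_nat(1)) simp
  have nz: "fps_cp_power (1 - (- fps_X) ^ Suc j) (cp_X (Suc j)) \<noteq> (0 :: 'k charpoly fps)" for j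
    by (rule fps_cp_power_nonzero[of _ "- ((- 1) ^ Suc j)" j])
      (simp only: mult_minus_left diff_conv_add_uminus power_minus[of fps_X])
  have "cp_eval_fps x (Abs_fps E) = (\<Prod>j<n. (1 - (- fps_X) ^ Suc j) ^ num_cycles n w (Suc j))"
    unfolding factor[symmetric]
    by (rule cp_eval_fps_has_prod[OF has_prod_E nz]) (unfold factor, simp add: num_cycles_eq_0[OF w])
  also have "\<dots> = (\<Prod>C\<in>orbit w ` {1..n}. 1 - (- fps_X) ^ card C)"
    by (rule prod_num_cycles[OF w])
  finally show ?thesis
    unfolding x_def[symmetric] by (metis cp_eval_fps_nth fps_nth_Abs_fps)
qed

section \<open>Substitution of monomials into power series\<close>

lemma mfps_coeff_0 [simp]: "mfps_coeff 0 a = 0"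
  by (simp add: zero_mfps.rep_eq)

lemma mfps_coeff_1: "mfps_coeff 1 a = (if a = 0 then 1 else 0)"
  by (simp add: one_mfps.rep_eq)

lemma mfps_coeff_mult: "mfps_coeff (f * g) a = (\<Sum>(b, c)\<in>splittings a. mfps_coeff f b * mfps_coeff g c)"
  by (simp add: times_mfps.rep_eq)

lemma mfps_coeff_sum: "mfps_coeff (\<Sum>i\<in>I. f i) a = (\<Sum>i\<in>I. mfps_coeff (f i) a)"
  by (induction I rule: infinite_finite_induct) (simp_all add: plus_mfps.rep_eq)

lemma mfps_const_mult_coeff:
  fixes f :: "('x, 'a::comm_ring_1) mfps"
  shows "mfps_coeff (mfps_const k * f) a = k * mfps_coeff f a"
proof -
  have "mfps_coeff (mfps_const k * f) a =
      (\<Sum>(b, c)\<in>{(0 :: 'x \<Rightarrow>\<^sub>0 nat, a)}. mfps_coeff (mfps_const k) b * mfps_coeff f c)"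
    unfolding mfps_coeff_mult
    by (rule sum.mono_neutral_right[OF finite_splittings])
      (auto simp: splittings_def mfps_const.rep_eq split: if_splits)
  then show ?thesis by (simp add: mfps_const.rep_eq)
qed

lemma mfps_const_mult: "mfps_const a * mfps_const b = (mfps_const (a * b) :: ('x, 'a::comm_ring_1) mfps)"
  by (auto simp: mfps_eq_iff mfps_const_mult_coeff mfps_const.rep_eq)

lemma mfps_of_nat: "of_nat n = (mfps_const (of_nat n) :: ('x, 'a::comm_ring_1) mfps)"
proof (induction n)
  case (Suc n)
  then show ?case by (simp add: mfps_eq_iff plus_mfps.rep_eq mfps_coeff_1 mfps_const.rep_eq)
qed (simp add: mfps_eq_iff mfps_const.rep_eq)

lemma mfps_inverse_eq:
  fixes f g :: "('x, 'a::comm_ring_1) mfps"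
  assumes "f * g = 1"
  shows "inverse f = g"
proof -
  have "f dvd 1" using assms by (metis dvdI)
  then have "f * inverse f = 1" by (rule mfps_mult_inverse)
  then have "g * (f * inverse f) = g" by simp
  then show ?thesis using assms by (simp add: mult.assoc[symmetric] mult.commute[of g f])
qed

definition mfps_monom :: "('x \<Rightarrow>\<^sub>0 nat) \<Rightarrow> ('x, 'a::zero_neq_one) mfps" where
  "mfps_monom e = Abs_mfps (\<lambda>a. if a = e then 1 else 0)"

lemma mfps_coeff_monom: "mfps_coeff (mfps_monom e) a = (if a = e then 1 else 0)"
  by (simp add: mfps_monom_def Abs_mfps_inverse)

lemma mfps_var_eq_monom: "mfps_var x = mfps_monom (Poly_Mapping.single x 1)"
  by (simp add: mfps_eq_iff mfps_coeff_monom mfps_var.rep_eq)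

lemma mfps_monom_0: "mfps_monom 0 = (1 :: ('x, 'a::comm_ring_1) mfps)"
  by (simp add: mfps_eq_iff mfps_coeff_monom mfps_coeff_1)

lemma mfps_coeff_monom_mult:
  fixes f :: "('x, 'a::comm_ring_1) mfps"
  shows "mfps_coeff (f * mfps_monom e) (a + e) = mfps_coeff f a"
proof -
  have "mfps_coeff (f * mfps_monom e) (a + e) = (\<Sum>(b, c)\<in>{(a, e)}. mfps_coeff f b * mfps_coeff (mfps_monom e) c)"
    unfolding mfps_coeff_mult
    by (rule sum.mono_neutral_right[OF finite_splittings])
      (auto simp: splittings_def mfps_coeff_monom split: if_splits)
  then show ?thesis by (simp add: mfps_coeff_monom)
qed

lemma mfps_monom_mult:
  "mfps_monom e * mfps_monom e' = (mfps_monom (e + e') :: ('x, 'a::comm_ring_1) mfps)"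
proof -
  have "mfps_coeff (mfps_monom e * mfps_monom e') a = mfps_coeff (mfps_monom (e + e') :: ('x, 'a) mfps) a" for a
  proof (cases "a = e + e'")
    case True
    then show ?thesis by (simp only: mfps_coeff_monom_mult) (simp add: mfps_coeff_monom)
  next
    case False
    then have "(\<Sum>(b, c)\<in>splittings a. mfps_coeff (mfps_monom e) b * mfps_coeff (mfps_monom e') c) = (0 :: 'a)"
      by (intro sum.neutral) (auto simp: splittings_def mfps_coeff_monom)
    with False show ?thesis by (simp add: mfps_coeff_mult mfps_coeff_monom)
  qed
  then show ?thesis by (simp add: mfps_eq_iff)
qed

lemma mfps_monom_prod:
  "(\<Prod>i\<in>I. mfps_monom (e i)) = (mfps_monom (\<Sum>i\<in>I. e i) :: ('x, 'a::comm_ring_1) mfps)"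
  by (induction I rule: infinite_finite_induct) (simp_all add: mfps_monom_0 mfps_monom_mult)

lemma mfps_monom_prod_mset:
  "(\<Prod>i\<in>#R. mfps_monom (e i)) = (mfps_monom (\<Sum>i\<in>#R. e i) :: ('x, 'a::comm_ring_1) mfps)"
  by (induction R) (simp_all add: mfps_monom_0 mfps_monom_mult)

text \<open>
  The exponent of the \<open>k\<close>-th power of the monomial with exponent \<open>e\<close>.
\<close>
definition mono_pow :: "('x \<Rightarrow>\<^sub>0 nat) \<Rightarrow> nat \<Rightarrow> ('x \<Rightarrow>\<^sub>0 nat)" where
  "mono_pow e k = (\<Sum>i<k. e)"

lemma lookup_mono_pow [simp]: "Poly_Mapping.lookup (mono_pow e k) x = k * Poly_Mapping.lookup e x"
  by (simp add: mono_pow_def lookup_sum)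

lemma mono_pow_0 [simp]: "mono_pow e 0 = 0"
  by (simp add: mono_pow_def)

lemma mono_pow_1 [simp]: "mono_pow e (Suc 0) = e"
  by (simp add: mono_pow_def)

lemma mono_pow_add: "mono_pow e (j + k) = mono_pow e j + mono_pow e k"
  by (rule poly_mapping_eqI) (simp add: lookup_add distrib_right)

lemma mono_pow_single: "mono_pow (Poly_Mapping.single x 1) k = Poly_Mapping.single x k"
  by (rule poly_mapping_eqI) (simp add: lookup_single when_def)

lemma mono_pow_inject:
  assumes "e \<noteq> 0"
  shows "mono_pow e j = mono_pow e k \<longleftrightarrow> j = k"
proof
  assume eq: "mono_pow e j = mono_pow e k"
  from assms obtain x where "Poly_Mapping.lookup e x \<noteq> 0"
    by (metis poly_mapping_eqI lookup_zero)
  with arg_cong[OF eq, of "\<lambda>p. Poly_Mapping.lookup p x"] show "j = k" by simp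
qed simp

lemma mfps_monom_power: "mfps_monom e ^ k = (mfps_monom (mono_pow e k) :: ('x, 'a::comm_ring_1) mfps)"
  using mfps_monom_prod[of "\<lambda>_. e" "{..<k}"] by (simp add: mono_pow_def)

text \<open>
  The substitution \<open>f \<mapsto> f(y)\<close> of the monomial \<open>y\<close> with exponent \<open>e\<close>. If \<open>e \<noteq> 0\<close>, the powers of \<open>y\<close> are
  distinct, the sum has at most one term, and the substitution is a ring homomorphism.
\<close>
definition mfps_subst :: "('x \<Rightarrow>\<^sub>0 nat) \<Rightarrow> 'a::comm_ring_1 fps \<Rightarrow> ('x, 'a) mfps" where
  "mfps_subst e f = Abs_mfps (\<lambda>a. \<Sum>k | mono_pow e k = a. fps_nth f k)"

lemma mfps_coeff_subst: "mfps_coeff (mfps_subst e f) a = (\<Sum>k | mono_pow e k = a. fps_nth f k)"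
  by (simp add: mfps_subst_def Abs_mfps_inverse)

lemma mfps_coeff_subst_mono_pow:
  assumes "e \<noteq> 0"
  shows "mfps_coeff (mfps_subst e f) (mono_pow e k) = fps_nth f k"
  using assms by (simp add: mfps_coeff_subst mono_pow_inject)

lemma mfps_coeff_subst_eq_0:
  assumes "\<And>k. a \<noteq> mono_pow e k"
  shows "mfps_coeff (mfps_subst e f) a = 0"
  using assms by (simp add: mfps_coeff_subst) (metis (mono_tags, lifting) empty_Collect_eq sum.empty)

lemma mfps_subst_eqI:
  assumes "e \<noteq> 0"
    and "\<And>k. mfps_coeff g (mono_pow e k) = fps_nth f k"
    and "\<And>a. (\<And>k. a \<noteq> mono_pow e k) \<Longrightarrow> mfps_coeff g a = 0"
  shows "mfps_subst e f = g"
  unfolding mfps_eq_iff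
  using assms by (metis mfps_coeff_subst_mono_pow mfps_coeff_subst_eq_0)

lemma mfps_subst_mult:
  fixes f g :: "'a::comm_ring_1 fps"
  assumes e: "e \<noteq> 0"
  shows "mfps_subst e (f * g) = mfps_subst e f * mfps_subst e g"
proof (rule mfps_subst_eqI[OF e])
  let ?c = "\<lambda>(b, c). mfps_coeff (mfps_subst e f) b * mfps_coeff (mfps_subst e g) c"
  have nz: "\<exists>i j. b = mono_pow e i \<and> c = mono_pow e j" if "?c (b, c) \<noteq> 0" for b c
    using that mfps_coeff_subst_eq_0[of b e f] mfps_coeff_subst_eq_0[of c e g] by fastforce
  fix k
  let ?h = "\<lambda>i. (mono_pow e i, mono_pow e (k - i))"
  have inj: "inj_on ?h {0..k}"
    using e by (auto simp: inj_on_def mono_pow_inject)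
  have "mfps_coeff (mfps_subst e f * mfps_subst e g) (mono_pow e k) = sum ?c (?h ` {0..k})"
    unfolding mfps_coeff_mult
  proof (rule sum.mono_neutral_right[OF finite_splittings])
    show "?h ` {0..k} \<subseteq> splittings (mono_pow e k)"
      by (auto simp: splittings_def mono_pow_add[symmetric])
    show "\<forall>p\<in>splittings (mono_pow e k) - ?h ` {0..k}. ?c p = 0"
    proof (intro ballI, rule ccontr)
      fix p assume p: "p \<in> splittings (mono_pow e k) - ?h ` {0..k}" and "?c p \<noteq> 0"
      with nz[of "fst p" "snd p"] obtain i j where ij: "p = (mono_pow e i, mono_pow e j)"
        by (metis prod.collapse)
      with p e have "i + j = k" by (auto simp: splittings_def mono_pow_add[symmetric] mono_pow_inject)
      with ij have "p = ?h i" "i \<in> {0..k}" by auto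
      with p show False by blast
    qed
  qed
  also have "\<dots> = (\<Sum>i = 0..k. fps_nth f i * fps_nth g (k - i))"
    using e by (subst sum.reindex[OF inj]) (simp add: mfps_coeff_subst_mono_pow)
  finally show "mfps_coeff (mfps_subst e f * mfps_subst e g) (mono_pow e k) = fps_nth (f * g) k"
    by (simp add: fps_mult_nth)
next
  fix a assume a: "\<And>k. a \<noteq> mono_pow e k"
  have "mfps_coeff (mfps_subst e f) b * mfps_coeff (mfps_subst e g) c = 0" if "b + c = a" for b c
  proof (rule ccontr)
    assume "mfps_coeff (mfps_subst e f) b * mfps_coeff (mfps_subst e g) c \<noteq> 0"
    then obtain i j where "b = mono_pow e i" "c = mono_pow e j"
      using mfps_coeff_subst_eq_0[of b e f] mfps_coeff_subst_eq_0[of c e g] by fastforce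
    with that a[of "i + j"] show False by (simp add: mono_pow_add)
  qed
  then show "mfps_coeff (mfps_subst e f * mfps_subst e g) a = 0"
    unfolding mfps_coeff_mult by (intro sum.neutral) (auto simp: splittings_def)
qed

lemma mfps_subst_1:
  assumes e: "e \<noteq> 0"
  shows "mfps_subst e 1 = 1"
proof (rule mfps_subst_eqI[OF e])
  fix k show "mfps_coeff 1 (mono_pow e k) = fps_nth 1 k"
    using mono_pow_inject[OF e, of k 0] by (simp add: mfps_coeff_1)
next
  fix a assume "\<And>k. a \<noteq> mono_pow e k"
  from this[of 0] show "mfps_coeff 1 a = 0" by (simp add: mfps_coeff_1)
qed

lemma mfps_subst_X:
  assumes e: "e \<noteq> 0"
  shows "mfps_subst e fps_X = mfps_monom e"
proof (rule mfps_subst_eqI[OF e])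
  fix k show "mfps_coeff (mfps_monom e) (mono_pow e k) = fps_nth fps_X k"
    using mono_pow_inject[OF e, of k "Suc 0"] by (simp add: mfps_coeff_monom)
next
  fix a assume "\<And>k. a \<noteq> mono_pow e k"
  from this[of "Suc 0"] show "mfps_coeff (mfps_monom e) a = 0" by (simp add: mfps_coeff_monom)
qed

lemma mfps_subst_add: "e \<noteq> 0 \<Longrightarrow> mfps_subst e (f + g) = mfps_subst e f + mfps_subst e g"
  by (rule mfps_subst_eqI)
    (simp_all add: plus_mfps.rep_eq mfps_coeff_subst_mono_pow mfps_coeff_subst_eq_0)

lemma mfps_subst_diff: "e \<noteq> 0 \<Longrightarrow> mfps_subst e (f - g) = mfps_subst e f - mfps_subst e g"
  by (rule mfps_subst_eqI)
    (simp_all add: minus_mfps.rep_eq mfps_coeff_subst_mono_pow mfps_coeff_subst_eq_0)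

lemma mfps_subst_prod:
  "e \<noteq> 0 \<Longrightarrow> mfps_subst e (\<Prod>i\<in>I. f i) = (\<Prod>i\<in>I. mfps_subst e (f i))"
  by (induction I rule: infinite_finite_induct) (simp_all add: mfps_subst_1 mfps_subst_mult)

lemma single_neq_0 [simp]: "Poly_Mapping.single x (Suc 0) \<noteq> 0"
  by (metis lookup_single_eq lookup_zero nat.simps(3))

text \<open>
  A product of univariate series in pairwise different variables is their tensor product, so its
  coefficients factor.
\<close>
lemma mfps_coeff_prod_subst_var:
  assumes "finite Z"
  shows "mfps_coeff (\<Prod>z\<in>Z. mfps_subst (Poly_Mapping.single z 1) (g z)) a =
    (if Poly_Mapping.keys a \<subseteq> Z then \<Prod>z\<in>Z. fps_nth (g z) (Poly_Mapping.lookup a z) else 0)"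
  using assms
proof (induction Z arbitrary: a rule: finite_induct)
  case empty
  then show ?case by (simp add: mfps_coeff_1)
next
  case (insert z Z)
  let ?P = "\<Prod>z\<in>Z. mfps_subst (Poly_Mapping.single z 1) (g z)"
  let ?s = "\<lambda>(b, c). mfps_coeff (mfps_subst (Poly_Mapping.single z 1) (g z)) b * mfps_coeff ?P c"
  \<comment> \<open>The only splitting of \<open>a\<close> into a power of \<open>z\<close> and a monomial free of \<open>z\<close>.\<close>
  let ?b = "Poly_Mapping.single z (Poly_Mapping.lookup a z)" and ?c = "Poly_Mapping.update z 0 a"
  have split: "?b + ?c = a"
    by (rule poly_mapping_eqI) (auto simp: lookup_add lookup_update lookup_single when_def)
  have "?s (b, c) = 0" if "b + c = a" "(b, c) \<noteq> (?b, ?c)" for b c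
  proof (rule ccontr)
    assume "?s (b, c) \<noteq> 0"
    then have nz: "mfps_coeff (mfps_subst (Poly_Mapping.single z 1) (g z)) b \<noteq> 0" "mfps_coeff ?P c \<noteq> 0"
      by auto
    from nz(1) obtain k where b: "b = mono_pow (Poly_Mapping.single z 1) k"
      by (metis mfps_coeff_subst_eq_0)
    from nz(2) have c: "Poly_Mapping.keys c \<subseteq> Z"
      unfolding insert.IH by presburger
    have "Poly_Mapping.lookup c z = 0"
      using c insert.hyps by (auto simp: in_keys_iff)
    then have "k = Poly_Mapping.lookup a z"
      using that(1) b by (auto simp: lookup_add mono_pow_single)
    then have "b = ?b" using b by (simp only: mono_pow_single)
    with that split show False by (metis add_left_imp_eq)
  qed
  then have "mfps_coeff (mfps_subst (Poly_Mapping.single z 1) (g z) * ?P) a = sum ?s {(?b, ?c)}"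
    unfolding mfps_coeff_mult
    using split by (intro sum.mono_neutral_right[OF finite_splittings]) (auto simp: splittings_def)
  also have "\<dots> = fps_nth (g z) (Poly_Mapping.lookup a z) * mfps_coeff ?P ?c"
    using mfps_coeff_subst_mono_pow[of "Poly_Mapping.single z 1" "g z"] by (simp add: mono_pow_single[simplified])
  also have "\<dots> = (if Poly_Mapping.keys a \<subseteq> insert z Z
      then \<Prod>z\<in>insert z Z. fps_nth (g z) (Poly_Mapping.lookup a z) else 0)"
  proof -
    have "Poly_Mapping.keys ?c \<subseteq> Z \<longleftrightarrow> Poly_Mapping.keys a \<subseteq> insert z Z"
      using insert.hyps by (auto simp: in_keys_iff lookup_update subset_iff)
    moreover have "(\<Prod>y\<in>Z. fps_nth (g y) (Poly_Mapping.lookup ?c y)) =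
        (\<Prod>y\<in>Z. fps_nth (g y) (Poly_Mapping.lookup a y))"
      using insert.hyps by (intro prod.cong refl) (auto simp: lookup_update)
    ultimately show ?thesis
      unfolding insert.IH using insert.hyps by simp
  qed
  finally show ?case using insert.hyps by simp
qed

section \<open>Logarithmic derivatives\<close>

lift_definition mfps_euler :: "'x \<Rightarrow> ('x, 'a::comm_ring_1) mfps \<Rightarrow> ('x, 'a) mfps" is
  "\<lambda>x f a. of_nat (Poly_Mapping.lookup a x) * f a" .

lemma mfps_euler_mult: "mfps_euler x (f * g) = mfps_euler x f * g + f * mfps_euler x g"
proof -
  have "of_nat (Poly_Mapping.lookup a x) * (\<Sum>(b, c)\<in>splittings a. mfps_coeff f b * mfps_coeff g c) =
     (\<Sum>(b, c)\<in>splittings a. of_nat (Poly_Mapping.lookup b x) * mfps_coeff f b * mfps_coeff g c) +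
     (\<Sum>(b, c)\<in>splittings a. mfps_coeff f b * (of_nat (Poly_Mapping.lookup c x) * mfps_coeff g c))" for a
    unfolding sum_distrib_left sum.distrib[symmetric]
    by (intro sum.cong refl) (auto simp: splittings_def lookup_add algebra_simps)
  then show ?thesis
    by (simp add: mfps_eq_iff mfps_euler.rep_eq plus_mfps.rep_eq mfps_coeff_mult)
qed

lemma mfps_euler_subst:
  assumes e: "Poly_Mapping.lookup e x = 1"
  shows "mfps_euler x (mfps_subst e f) = mfps_subst e (fps_X * fps_deriv f)"
proof -
  from e have [simp]: "e \<noteq> 0" by auto
  show ?thesis
  proof (rule mfps_subst_eqI[symmetric])
    fix k show "mfps_coeff (mfps_euler x (mfps_subst e f)) (mono_pow e k) = fps_nth (fps_X * fps_deriv f) k"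
      using e by (cases k) (simp_all add: mfps_euler.rep_eq mfps_coeff_subst_mono_pow del: of_nat_Suc)
  qed (simp_all add: mfps_euler.rep_eq mfps_coeff_subst_eq_0)
qed

text \<open>
  \<open>g\<close> is 1 where \<open>x = 0\<close>, and its logarithmic derivative with respect to \<open>x d/dx\<close> is \<open>l\<close>. That \<open>l\<close>
  vanishes where \<open>x = 0\<close> is what makes \<open>D g = l g\<close> a recurrence: the coefficients of \<open>g\<close> of degree \<open>n\<close> in
  \<open>x\<close> are expressed by those of smaller degree.
\<close>
definition has_log_euler :: "'x \<Rightarrow> ('x, 'a::comm_ring_1) mfps \<Rightarrow> ('x, 'a) mfps \<Rightarrow> bool" where
  "has_log_euler x g l \<longleftrightarrow> mfps_euler x g = l * g \<and>
    (\<forall>a. Poly_Mapping.lookup a x = 0 \<longrightarrow> mfps_coeff g a = mfps_coeff 1 a \<and> mfps_coeff l a = 0)"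

lemma has_log_euler_1: "has_log_euler x 1 0"
  by (auto simp: has_log_euler_def mfps_eq_iff mfps_euler.rep_eq mfps_coeff_1)

lemma has_log_euler_mult:
  assumes "has_log_euler x f k" "has_log_euler x g l"
  shows "has_log_euler x (f * g) (k + l)"
proof -
  have "mfps_coeff (f * g) a = mfps_coeff 1 a" if a: "Poly_Mapping.lookup a x = 0" for a
  proof -
    have "mfps_coeff (f * g) a = mfps_coeff (1 * 1) a"
      unfolding mfps_coeff_mult
      using assms a by (intro sum.cong refl) (auto simp: has_log_euler_def splittings_def lookup_add)
    then show ?thesis by simp
  qed
  with assms show ?thesis
    by (simp add: has_log_euler_def mfps_euler_mult algebra_simps plus_mfps.rep_eq)
qed

lemma has_log_euler_prod:
  assumes "\<And>i. i \<in> I \<Longrightarrow> has_log_euler x (f i) (l i)"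
  shows "has_log_euler x (\<Prod>i\<in>I. f i) (\<Sum>i\<in>I. l i)"
  using assms
  by (induction I rule: infinite_finite_induct) (simp_all add: has_log_euler_1 has_log_euler_mult)

text \<open>
  The Euler derivation maps \<open>f(y)\<close> to \<open>(X f')(y)\<close> when \<open>y\<close> is linear in \<open>x\<close>, so the logarithmic
  derivative can be computed in one variable.
\<close>
lemma has_log_euler_subst:
  assumes e: "Poly_Mapping.lookup e x = 1" and f: "fps_nth f 0 = 1" "fps_X * fps_deriv f = l * f"
  shows "has_log_euler x (mfps_subst e f) (mfps_subst e l)"
proof -
  from e have [simp]: "e \<noteq> 0" by auto
  have l0: "fps_nth l 0 = 0"
    using arg_cong[OF f(2), of "\<lambda>h. fps_nth h 0"] f(1) by simp
  have "mfps_coeff (mfps_subst e f) a = mfps_coeff 1 a \<and> mfps_coeff (mfps_subst e l) a = 0"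
    if a: "Poly_Mapping.lookup a x = 0" for a
  proof (cases "\<exists>k. a = mono_pow e k")
    case True
    with a e have "a = mono_pow e 0" by auto
    then show ?thesis
      using f l0 mfps_coeff_subst_mono_pow[of e f 0] mfps_coeff_subst_mono_pow[of e l 0]
      by (simp add: mfps_coeff_1)
  next
    case False
    then have "a \<noteq> 0" by (metis mono_pow_0)
    with False show ?thesis by (simp add: mfps_coeff_subst_eq_0 mfps_coeff_1)
  qed
  then show ?thesis
    by (simp add: has_log_euler_def mfps_euler_subst[OF e] f mfps_subst_mult)
qed

text \<open>
  By induction on the degree of a monomial in \<open>x\<close>: its coefficient in \<open>D g = l g\<close> involves finitely many
  coefficients of \<open>l\<close>, and coefficients of \<open>g\<close> at monomials of smaller degree. In characteristic 0 the
  positive degree on the left can be cancelled.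
\<close>
lemma tendsto_if_log_euler_tendsto:
  fixes F :: "('x, 'k::field_char_0) mfps"
  assumes G: "\<And>i. has_log_euler x (G i) (L i)" and F: "has_log_euler x F M"
    and lim: "(L \<longlongrightarrow> M) net"
  shows "(G \<longlongrightarrow> F) net"
  unfolding tendsto_mfps_iff
proof
  fix a
  show "\<forall>\<^sub>F i in net. mfps_coeff (G i) a = mfps_coeff F a"
  proof (induction "Poly_Mapping.lookup a x" arbitrary: a rule: less_induct)
    case less
    show ?case
    proof (cases "Poly_Mapping.lookup a x = 0")
      case True
      then show ?thesis using G F by (simp add: has_log_euler_def)
    next
      case False
      have L: "\<forall>\<^sub>F i in net. \<forall>p\<in>splittings a. mfps_coeff (L i) (fst p) = mfps_coeff M (fst p)"
        using lim by (simp add: eventually_ball_finite_distrib tendsto_mfps_iff)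
      have "\<forall>\<^sub>F i in net. Poly_Mapping.lookup (fst p) x \<noteq> 0 \<longrightarrow>
          mfps_coeff (G i) (snd p) = mfps_coeff F (snd p)" if "p \<in> splittings a" for p
      proof (cases "Poly_Mapping.lookup (fst p) x = 0")
        case False
        with that have "Poly_Mapping.lookup (snd p) x < Poly_Mapping.lookup a x"
          by (auto simp: splittings_def lookup_add)
        from less[OF this] show ?thesis by eventually_elim simp
      qed simp
      then have "\<forall>\<^sub>F i in net. \<forall>p\<in>splittings a. Poly_Mapping.lookup (fst p) x \<noteq> 0 \<longrightarrow>
          mfps_coeff (G i) (snd p) = mfps_coeff F (snd p)"
        by (simp add: eventually_ball_finite_distrib)
      with L show ?thesis
      proof eventually_elim
        case (elim i)
        have "mfps_coeff (L i * G i) a = mfps_coeff (M * F) a"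
          unfolding mfps_coeff_mult
        proof (rule sum.cong[OF refl], clarify)
          fix b c assume bc: "(b, c) \<in> splittings a"
          show "mfps_coeff (L i) b * mfps_coeff (G i) c = mfps_coeff M b * mfps_coeff F c"
          proof (cases "Poly_Mapping.lookup b x = 0")
            case True
            then show ?thesis using G F by (simp add: has_log_euler_def)
          next
            case False
            then show ?thesis using elim bc by fastforce
          qed
        qed
        then have "mfps_coeff (mfps_euler x (G i)) a = mfps_coeff (mfps_euler x F) a"
          using G F by (simp add: has_log_euler_def)
        with False show ?case by (simp add: mfps_euler.rep_eq)
      qed
    qed
  qed
qed

section \<open>The generating function of the averages\<close>

definition gf_vars :: "nat \<Rightarrow> nat \<Rightarrow> gf_var set" where
  "gf_vars l m = T ` {1..l} \<union> U ` {1..m} \<union> {V}"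

lemma finite_gf_vars [simp]: "finite (gf_vars l m)"
  by (simp add: gf_vars_def)

lemma prod_gf_vars:
  "(\<Prod>z\<in>gf_vars l m. h z) = (\<Prod>i=1..l. h (T i)) * (\<Prod>j=1..m. h (U j)) * h V"
proof -
  have "(\<Prod>z\<in>gf_vars l m. h z) = (\<Prod>z\<in>T ` {1..l}. h z) * (\<Prod>z\<in>U ` {1..m}. h z) * h V"
    unfolding gf_vars_def
    by (subst prod.union_disjoint, simp_all, blast)+
  then show ?thesis by (simp add: prod.reindex inj_on_def)
qed

text \<open>
  The contribution of a cycle of length \<open>c\<close> to the series in the variable \<open>z\<close>. The contribution of \<open>V\<close>
  records the length, so that the product over the cycles of a permutation of \<open>{1..n}\<close> carries \<open>v\<^sup>n\<close>.
\<close>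
definition cycle_series :: "nat \<Rightarrow> gf_var \<Rightarrow> 'k::field fps" where
  "cycle_series c z = (case z of T i \<Rightarrow> inverse (1 - fps_X ^ c) | U j \<Rightarrow> 1 - (- fps_X) ^ c | V \<Rightarrow> fps_X ^ c)"

definition cycle_weight :: "nat \<Rightarrow> nat \<Rightarrow> nat \<Rightarrow> (gf_var, 'k::field) mfps" where
  "cycle_weight l m c = (\<Prod>z\<in>gf_vars l m. mfps_subst (Poly_Mapping.single z 1) (cycle_series c z))"

text \<open>
  Exchanging the product over the cycles with the product over the variables leaves one univariate series
  in each variable, and then the coefficients factor.
\<close>
lemma mfps_coeff_prod_cycle_weight:
  "mfps_coeff (\<Prod>C\<in>I. cycle_weight l m (card C)) a =
    (if Poly_Mapping.keys a \<subseteq> gf_vars l m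
     then \<Prod>z\<in>gf_vars l m. fps_nth (\<Prod>C\<in>I. cycle_series (card C) z) (Poly_Mapping.lookup a z) else 0)"
proof -
  have "(\<Prod>C\<in>I. cycle_weight l m (card C) :: (gf_var, 'a) mfps) = (\<Prod>z\<in>gf_vars l m.
      mfps_subst (Poly_Mapping.single z 1) (\<Prod>C\<in>I. cycle_series (card C) z))"
    unfolding cycle_weight_def by (subst prod.swap) (simp add: mfps_subst_prod)
  then show ?thesis by (simp only: mfps_coeff_prod_subst_var[OF finite_gf_vars])
qed

lemma mfps_coeff_cycle_weight:
  "mfps_coeff (cycle_weight l m c) a =
    (if Poly_Mapping.keys a \<subseteq> gf_vars l m
     then \<Prod>z\<in>gf_vars l m. fps_nth (cycle_series c z) (Poly_Mapping.lookup a z) else 0)"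
  unfolding cycle_weight_def by (rule mfps_coeff_prod_subst_var[OF finite_gf_vars])

lemma mfps_coeff_cycle_weight_eq_0:
  assumes "Poly_Mapping.lookup a V \<noteq> c"
  shows "mfps_coeff (cycle_weight l m c) a = 0"
  using assms by (simp add: mfps_coeff_cycle_weight prod_gf_vars cycle_series_def fps_X_power_nth)

definition cycle_average :: "nat \<Rightarrow> nat \<Rightarrow> nat \<Rightarrow> (gf_var, 'k::field_char_0) mfps" where
  "cycle_average l m n = mfps_const (1 / fact n) * cycle_sum (cycle_weight l m) {1..n}"

lemma cycle_average_0: "cycle_average l m 0 = (1 :: (gf_var, 'k::field_char_0) mfps)"
  by (simp add: cycle_average_def cycle_sum_def mfps_eq_iff mfps_const_mult_coeff mfps_const.rep_eq mfps_coeff_1)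

text \<open>
  In \<open>cycle_sum_Suc\<close>, multiplied by \<open>1/n!\<close>, the coefficient \<open>n!/(n-c)!\<close> becomes \<open>1/(n-c)!\<close>, which is the
  normalisation of the average on \<open>n - c\<close> points.
\<close>
lemma cycle_average_Suc:
  "mfps_const (of_nat (Suc n)) * cycle_average l m (Suc n) =
    (\<Sum>c\<le>n. cycle_weight l m (Suc c) * cycle_average l m (n - c) :: (gf_var, 'k::field_char_0) mfps)"
proof -
  have "mfps_const (of_nat (Suc n)) * cycle_average l m (Suc n) =
      mfps_const (1 / fact n) * (cycle_sum (cycle_weight l m) {1..Suc n} :: (gf_var, 'k) mfps)"
    unfolding cycle_average_def mult.assoc[symmetric] mfps_const_mult by (simp del: of_nat_Suc)
  also have "\<dots> = (\<Sum>c\<le>n. mfps_const (1 / fact n) * (of_nat (fact c * (n choose c)) *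
      cycle_weight l m (Suc c) * cycle_sum (cycle_weight l m) {1..n - c}))"
    unfolding cycle_sum_Suc by (rule sum_distrib_left)
  also have "\<dots> = (\<Sum>c\<le>n. cycle_weight l m (Suc c) * cycle_average l m (n - c))"
  proof (rule sum.cong[OF refl])
    fix c assume "c \<in> {..n}"
    then have "1 / fact n * of_nat (fact c * (n choose c)) = (1 / fact (n - c) :: 'k)"
      by (simp add: binomial_fact)
    then have "mfps_const (1 / fact n) * of_nat (fact c * (n choose c)) =
        (mfps_const (1 / fact (n - c)) :: (gf_var, 'k) mfps)"
      by (simp only: mfps_of_nat mfps_const_mult)
    then show "mfps_const (1 / fact n) * (of_nat (fact c * (n choose c)) *
        cycle_weight l m (Suc c) * cycle_sum (cycle_weight l m) {1..n - c}) =
        cycle_weight l m (Suc c) * (cycle_average l m (n - c) :: (gf_var, 'k) mfps)"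
      unfolding cycle_average_def by (simp only: mult.assoc[symmetric]) (simp only: ac_simps)
  qed
  finally show ?thesis .
qed

text \<open>
  The series \<open>\<Sum>\<^sub>n A\<^sub>n\<close> of the averages. As \<open>A\<^sub>n\<close> is homogeneous of degree \<open>n\<close> in \<open>v\<close>, only one of them
  contributes to a given coefficient, so the infinite sum can be defined coefficientwise. The series
  \<open>weight_gf\<close> of the cycle weights below is defined in the same way.
\<close>
definition cycle_gf :: "nat \<Rightarrow> nat \<Rightarrow> (gf_var, 'k::field_char_0) mfps" where
  "cycle_gf l m = Abs_mfps (\<lambda>a. mfps_coeff (cycle_average l m (Poly_Mapping.lookup a V)) a)"

lemma mfps_coeff_cycle_gf:
  "mfps_coeff (cycle_gf l m) a = mfps_coeff (cycle_average l m (Poly_Mapping.lookup a V)) a"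
  by (simp add: cycle_gf_def Abs_mfps_inverse)

definition weight_gf :: "nat \<Rightarrow> nat \<Rightarrow> (gf_var, 'k::field) mfps" where
  "weight_gf l m = Abs_mfps (\<lambda>a. if Poly_Mapping.lookup a V = 0 then 0
     else mfps_coeff (cycle_weight l m (Poly_Mapping.lookup a V)) a)"

lemma mfps_coeff_weight_gf:
  "mfps_coeff (weight_gf l m) a = (if Poly_Mapping.lookup a V = 0 then 0
     else mfps_coeff (cycle_weight l m (Poly_Mapping.lookup a V)) a)"
  by (simp add: weight_gf_def Abs_mfps_inverse)

text \<open>
  In the coefficient at \<open>a\<close> the recurrence \<open>cycle_average_Suc\<close> reads \<open>D F = l F\<close>: a splitting \<open>a = b + d\<close>
  meets only the summand for which the cycle length is the degree of \<open>b\<close> in \<open>v\<close>.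
\<close>
lemma has_log_euler_cycle_gf:
  "has_log_euler V (cycle_gf l m) (weight_gf l m :: (gf_var, 'k::field_char_0) mfps)"
proof -
  let ?A = "cycle_average l m :: nat \<Rightarrow> (gf_var, 'k) mfps" and ?w = "cycle_weight l m :: nat \<Rightarrow> (gf_var, 'k) mfps"
  have "mfps_coeff (mfps_euler V (cycle_gf l m)) a =
      mfps_coeff (weight_gf l m * cycle_gf l m :: (gf_var, 'k) mfps) a" for a
  proof (cases "Poly_Mapping.lookup a V")
    case 0
    then have "mfps_coeff (weight_gf l m * cycle_gf l m :: (gf_var, 'k) mfps) a = 0"
      unfolding mfps_coeff_mult
      by (intro sum.neutral) (auto simp: splittings_def lookup_add mfps_coeff_weight_gf)
    with 0 show ?thesis by (simp add: mfps_euler.rep_eq)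
  next
    case (Suc n)
    have "mfps_coeff (mfps_euler V (cycle_gf l m)) a = mfps_coeff (mfps_const (of_nat (Suc n)) * ?A (Suc n)) a"
      by (simp only: mfps_euler.rep_eq mfps_coeff_cycle_gf Suc mfps_const_mult_coeff)
    also have "\<dots> = (\<Sum>(b, d)\<in>splittings a. \<Sum>c\<le>n. mfps_coeff (?w (Suc c)) b * mfps_coeff (?A (n - c)) d)"
      unfolding cycle_average_Suc mfps_coeff_sum mfps_coeff_mult case_prod_unfold by (rule sum.swap)
    also have "\<dots> = mfps_coeff (weight_gf l m * cycle_gf l m) a"
      unfolding mfps_coeff_mult
    proof (rule sum.cong[OF refl], clarify)
      fix b d assume "(b, d) \<in> splittings a"
      with Suc have bd: "Poly_Mapping.lookup b V + Poly_Mapping.lookup d V = Suc n"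
        by (auto simp: splittings_def lookup_add)
      show "(\<Sum>c\<le>n. mfps_coeff (?w (Suc c)) b * mfps_coeff (?A (n - c)) d) =
          mfps_coeff (weight_gf l m) b * mfps_coeff (cycle_gf l m) d"
      proof (cases "Poly_Mapping.lookup b V")
        case 0
        then show ?thesis
          by (intro trans[OF sum.neutral]) (auto simp: mfps_coeff_weight_gf mfps_coeff_cycle_weight_eq_0)
      next
        case (Suc k)
        have "(\<Sum>c\<le>n. mfps_coeff (?w (Suc c)) b * mfps_coeff (?A (n - c)) d) =
            (\<Sum>c\<in>{k}. mfps_coeff (?w (Suc c)) b * mfps_coeff (?A (n - c)) d)"
          using Suc bd by (intro sum.mono_neutral_right) (auto simp: mfps_coeff_cycle_weight_eq_0)
        moreover have "n - k = Poly_Mapping.lookup d V" using bd Suc by simp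
        ultimately show ?thesis
          using Suc by (simp add: mfps_coeff_weight_gf mfps_coeff_cycle_gf)
      qed
    qed
    finally show ?thesis .
  qed
  then show ?thesis
    by (auto simp: has_log_euler_def mfps_eq_iff mfps_coeff_cycle_gf mfps_coeff_weight_gf cycle_average_0)
qed

text \<open>
  The coefficient at \<open>t\<^sup>\<lambda> u\<^sup>\<mu> v\<^sup>n\<close> of the weight of \<open>w\<close> is the value at \<open>w\<close> of \<open>H\<^sub>\<lambda> E\<^sub>\<mu>\<close>.
\<close>
lemma mfps_coeff_cycle_gf_eq_avg:
  "mfps_coeff (cycle_gf l m) a = (if Poly_Mapping.keys a \<subseteq> gf_vars l m
    then cp_avg (Poly_Mapping.lookup a V) ((\<Prod>i=1..l. H (Poly_Mapping.lookup a (T i))) *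
      (\<Prod>j=1..m. E (Poly_Mapping.lookup a (U j)))) else (0 :: 'k::field_char_0))"
proof -
  define n where "n = Poly_Mapping.lookup a V"
  let ?W = "\<lambda>w. \<Prod>C\<in>orbit w ` {1..n}. cycle_weight l m (card C) :: (gf_var, 'k) mfps"
  let ?q = "(\<Prod>i=1..l. H (Poly_Mapping.lookup a (T i))) *
      (\<Prod>j=1..m. E (Poly_Mapping.lookup a (U j))) :: 'k charpoly"
  have "mfps_coeff (?W w) a = (if Poly_Mapping.keys a \<subseteq> gf_vars l m
      then cp_eval (\<lambda>i. of_nat (num_cycles n w i)) ?q else 0)" if w: "w permutes {1..n}" for w
  proof -
    have "(\<Prod>C\<in>orbit w ` {1..n}. fps_X ^ card C) = (fps_X ^ n :: 'k fps)"
      unfolding power_sum[symmetric] sum_card_orbits[OF w] ..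
    then have "(\<Prod>z\<in>gf_vars l m. fps_nth (\<Prod>C\<in>orbit w ` {1..n}. cycle_series (card C) z) (Poly_Mapping.lookup a z))
        = cp_eval (\<lambda>i. of_nat (num_cycles n w i)) ?q"
      unfolding prod_gf_vars cycle_series_def cp_eval_mult cp_eval_prod cp_eval_H[OF w] cp_eval_E[OF w]
      by (simp add: n_def)
    then show ?thesis by (simp only: mfps_coeff_prod_cycle_weight)
  qed
  then have "(\<Sum>w | w permutes {1..n}. mfps_coeff (?W w) a) =
      (\<Sum>w | w permutes {1..n}. if Poly_Mapping.keys a \<subseteq> gf_vars l m
      then cp_eval (\<lambda>i. of_nat (num_cycles n w i)) ?q else 0)"
    by (intro sum.cong refl) simp
  then show ?thesis
    unfolding mfps_coeff_cycle_gf n_def[symmetric] cycle_average_def mfps_const_mult_coeff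
      cycle_sum_def mfps_coeff_sum cp_avg_def
    by simp
qed

section \<open>The sum side\<close>

definition series_monom :: "(nat \<Rightarrow> nat) \<Rightarrow> (nat \<Rightarrow> nat) \<Rightarrow> nat \<Rightarrow> nat \<Rightarrow> nat \<Rightarrow> (gf_var \<Rightarrow>\<^sub>0 nat)" where
  "series_monom lam mu l m n = (\<Sum>i=1..l. Poly_Mapping.single (T i) (lam i)) +
     (\<Sum>j=1..m. Poly_Mapping.single (U j) (mu j)) + Poly_Mapping.single V n"

lemma lookup_series_monom [simp]:
  "Poly_Mapping.lookup (series_monom lam mu l m n) (T i) = (if i \<in> {1..l} then lam i else 0)"
  "Poly_Mapping.lookup (series_monom lam mu l m n) (U j) = (if j \<in> {1..m} then mu j else 0)"
  "Poly_Mapping.lookup (series_monom lam mu l m n) V = n"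
  by (simp_all add: series_monom_def lookup_add lookup_sum lookup_single when_def)

lemma mfps_monom_series_monom:
  "mfps_monom (series_monom lam mu l m n) =
    (\<Prod>i=1..l. t i ^ lam i) * (\<Prod>j=1..m. u j ^ mu j) * (v ^ n :: (gf_var, 'k::comm_ring_1) mfps)"
  by (simp add: series_monom_def mfps_var_eq_monom mfps_monom_power mono_pow_single[simplified]
      mfps_monom_prod mfps_monom_mult)

lemma gf_monom_eqI:
  assumes "\<And>i. Poly_Mapping.lookup a (T i) = Poly_Mapping.lookup b (T i)"
    "\<And>j. Poly_Mapping.lookup a (U j) = Poly_Mapping.lookup b (U j)"
    "Poly_Mapping.lookup a V = Poly_Mapping.lookup b V"
  shows "a = b"
proof (rule poly_mapping_eqI)
  fix z show "Poly_Mapping.lookup a z = Poly_Mapping.lookup b z"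
    using assms by (cases z) auto
qed

lemma keys_subset_gf_vars:
  "Poly_Mapping.keys a \<subseteq> gf_vars l m \<longleftrightarrow>
    (\<forall>i. Poly_Mapping.lookup a (T i) \<noteq> 0 \<longrightarrow> i \<in> {1..l}) \<and>
    (\<forall>j. Poly_Mapping.lookup a (U j) \<noteq> 0 \<longrightarrow> j \<in> {1..m})"
proof -
  have "(\<forall>z. Poly_Mapping.lookup a z \<noteq> 0 \<longrightarrow> z \<in> gf_vars l m) \<longleftrightarrow>
    (\<forall>i. Poly_Mapping.lookup a (T i) \<noteq> 0 \<longrightarrow> T i \<in> gf_vars l m) \<and>
    (\<forall>j. Poly_Mapping.lookup a (U j) \<noteq> 0 \<longrightarrow> U j \<in> gf_vars l m) \<and>
    (Poly_Mapping.lookup a V \<noteq> 0 \<longrightarrow> V \<in> gf_vars l m)"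
    by (metis gf_var.exhaust)
  then show ?thesis
    by (auto simp: subset_iff in_keys_iff gf_vars_def)
qed

text \<open>
  Each monomial in the variables concerned is \<open>t\<^sup>\<lambda> u\<^sup>\<mu> v\<^sup>n\<close> for exactly one index of the sum, so every
  coefficient is constant as soon as that index is included.
\<close>
lemma has_sum_cycle_gf:
  "((\<lambda>(n, lam, mu).
      mfps_const (cp_avg n ((\<Prod>i=1..l. H (lam i)) * (\<Prod>j=1..m. E (mu j))))
      * (\<Prod>i=1..l. t i ^ lam i) * (\<Prod>j=1..m. u j ^ mu j) * v ^ n)
    has_sum (cycle_gf l m :: (gf_var, 'k::field_char_0) mfps))
    ((UNIV :: nat set) \<times> ({1..l} \<rightarrow>\<^sub>E (UNIV :: nat set)) \<times> ({1..m} \<rightarrow>\<^sub>E (UNIV :: nat set)))"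
  (is "(?h has_sum _) ?I")
proof -
  define k :: "nat \<times> (nat \<Rightarrow> nat) \<times> (nat \<Rightarrow> nat) \<Rightarrow> 'k" where
    "k = (\<lambda>(n, lam, mu). cp_avg n ((\<Prod>i=1..l. H (lam i)) * (\<Prod>j=1..m. E (mu j))))"
  define e where "e = (\<lambda>(n, lam, mu). series_monom lam mu l m n)"
  have coeff: "mfps_coeff (?h p) a = (if e p = a then k p else 0)" for p a
  proof -
    have "?h p = mfps_const (k p) * mfps_monom (e p)"
      by (cases p) (simp only: e_def k_def prod.case mfps_monom_series_monom mult.assoc)
    then show ?thesis by (simp add: mfps_const_mult_coeff mfps_coeff_monom)
  qed
  have "\<forall>\<^sub>F X in finite_subsets_at_top ?I. mfps_coeff (sum ?h X) a =
      mfps_coeff (cycle_gf l m :: (gf_var, 'k) mfps) a" for a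
  proof (cases "Poly_Mapping.keys a \<subseteq> gf_vars l m")
    case True
    define p where "p = (Poly_Mapping.lookup a V, restrict (\<lambda>i. Poly_Mapping.lookup a (T i)) {1..l},
      restrict (\<lambda>j. Poly_Mapping.lookup a (U j)) {1..m})"
    have pI: "p \<in> ?I" by (auto simp: p_def)
    have ep: "e p = a"
      using True unfolding keys_subset_gf_vars
      by (intro gf_monom_eqI) (auto simp: e_def p_def)
    have uniq: "q = p" if "q \<in> ?I" "e q = a" for q
    proof -
      obtain n lam mu where q: "q = (n, lam, mu)" by (cases q)
      with that have "lam \<in> extensional {1..l}" "mu \<in> extensional {1..m}" by (auto simp: PiE_def)
      with q that(2)[symmetric] show ?thesis
        by (auto simp: p_def e_def extensional_def restrict_def)
    qed
    have kp: "k p = mfps_coeff (cycle_gf l m) a"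
      using True by (simp add: mfps_coeff_cycle_gf_eq_avg k_def p_def)
    have "mfps_coeff (sum ?h X) a = mfps_coeff (cycle_gf l m) a" if X: "finite X" "{p} \<subseteq> X" "X \<subseteq> ?I" for X
    proof -
      have "mfps_coeff (sum ?h X) a = (\<Sum>q\<in>{p}. if e q = a then k q else 0)"
        unfolding mfps_coeff_sum coeff
      proof (rule sum.mono_neutral_right[OF X(1,2)], intro ballI)
        fix q assume "q \<in> X - {p}"
        with X(3) uniq[of q] have "e q \<noteq> a" by blast
        then show "(if e q = a then k q else 0) = 0" by simp
      qed
      then show ?thesis by (simp add: ep kp)
    qed
    then show ?thesis
      unfolding eventually_finite_subsets_at_top using pI by (intro exI[of _ "{p}"]) auto
  next
    case False
    have "e q \<noteq> a" for q
    proof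
      assume "e q = a"
      with False show False
        unfolding keys_subset_gf_vars by (cases q) (auto simp: e_def split: if_splits)
    qed
    then have "mfps_coeff (sum ?h X) a = 0" for X
      unfolding mfps_coeff_sum coeff by simp
    with False show ?thesis by (simp add: mfps_coeff_cycle_gf_eq_avg)
  qed
  then show ?thesis by (simp add: has_sum_def tendsto_mfps_iff)
qed

section \<open>The product side\<close>

definition factor_monom :: "nat multiset \<Rightarrow> nat set \<Rightarrow> (gf_var \<Rightarrow>\<^sub>0 nat)" where
  "factor_monom R S = (\<Sum>j\<in>S. Poly_Mapping.single (U j) 1) + (\<Sum>i\<in>#R. Poly_Mapping.single (T i) 1)
     + Poly_Mapping.single V 1"

lemma lookup_sum_mset_single:
  "Poly_Mapping.lookup (\<Sum>i\<in>#R. Poly_Mapping.single (f i) (1::nat)) z = size (filter_mset (\<lambda>i. f i = z) R)"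
  by (induction R) (auto simp: lookup_add lookup_single)

lemma lookup_factor_monom:
  "Poly_Mapping.lookup (factor_monom R S) (T i) = count R i"
  "finite S \<Longrightarrow> Poly_Mapping.lookup (factor_monom R S) (U j) = (if j \<in> S then 1 else 0)"
  "Poly_Mapping.lookup (factor_monom R S) V = 1"
  by (simp_all add: factor_monom_def lookup_add lookup_sum lookup_sum_mset_single[simplified]
      lookup_single when_def count_conv_size_mset)

lemma factor_monom_nonzero [simp]: "factor_monom R S \<noteq> 0"
  by (metis lookup_factor_monom(3) lookup_zero zero_neq_one)

lemma mfps_monom_factor_monom:
  "(\<Prod>j\<in>S. u j) * (\<Prod>i\<in>#R. t i) * v = (mfps_monom (factor_monom R S) :: (gf_var, 'k::comm_ring_1) mfps)"
  by (simp only: factor_monom_def mfps_var_eq_monom mfps_monom_prod mfps_monom_prod_mset mfps_monom_mult)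

text \<open>
  The factor of \<open>(R, S)\<close>, as a series in \<open>u\<^sup>S t\<^sup>R v\<close>, depends on \<open>p = |S|\<close> alone.
\<close>
definition factor_series :: "nat \<Rightarrow> 'k::field fps" where
  "factor_series p = (if odd p then 1 + fps_X else inverse (1 - fps_X))"

definition factor_log_series :: "nat \<Rightarrow> 'k::field fps" where
  "factor_log_series p = Abs_fps (\<lambda>k. if k = 0 then 0 else (- 1) ^ (p * Suc k))"

lemma factor_log_series_nth:
  "fps_nth (factor_log_series p) k = (if k = 0 then 0 else if odd p then (- 1) ^ Suc k else (1 :: 'k::field))"
  by (simp add: factor_log_series_def power_mult del: mult_Suc_right power_Suc)

text \<open>
  The logarithmic derivative is \<open>X/(1 + X)\<close> for odd \<open>p\<close> and \<open>X/(1 - X)\<close> for even \<open>p\<close>.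
\<close>
lemma factor_log_series:
  "fps_X * fps_deriv (factor_series p) = factor_log_series p * (factor_series p :: 'k::field fps)"
proof (cases "odd p")
  case True
  have "factor_log_series p * (1 + fps_X) = (fps_X :: 'k fps)"
  proof (rule fps_ext)
    fix k show "fps_nth (factor_log_series p * (1 + fps_X)) k = fps_nth (fps_X :: 'k fps) k"
      using True by (cases k; cases "k - 1")
        (auto simp: distrib_left factor_log_series_nth)
  qed
  with True show ?thesis by (simp add: factor_series_def)
next
  case False
  have "factor_log_series p * (1 - fps_X) = (fps_X :: 'k fps)"
  proof (rule fps_ext)
    fix k show "fps_nth (factor_log_series p * (1 - fps_X)) k = fps_nth (fps_X :: 'k fps) k"
      using False by (cases k; cases "k - 1")
        (auto simp: right_diff_distrib factor_log_series_nth)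
  qed
  moreover have inv: "(1 - fps_X) * inverse (1 - fps_X) = (1 :: 'k fps)"
    by (rule inverse_mult_eq_1') simp
  ultimately have "factor_log_series p = fps_X * (inverse (1 - fps_X) :: 'k fps)"
    by (metis mult.assoc mult.right_neutral)
  with False show ?thesis
    by (simp add: factor_series_def fps_inverse_deriv power2_eq_square mult.assoc)
qed

text \<open>
  Substitution is multiplicative, so only the univariate series \<open>1 - X\<close> has to be inverted.
\<close>
lemma factor_eq:
  fixes A :: "nat set"
  assumes "finite A"
  shows "(\<Prod>S | S \<subseteq> A \<and> odd (card S). 1 + (\<Prod>j\<in>S. u j) * (\<Prod>i\<in>#R. t i) * v)
        / (\<Prod>S | S \<subseteq> A \<and> even (card S). 1 - (\<Prod>j\<in>S. u j) * (\<Prod>i\<in>#R. t i) * v)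
    = (\<Prod>S\<in>Pow A. mfps_subst (factor_monom R S) (factor_series (card S)) :: (gf_var, 'k::field) mfps)"
proof -
  let ?g = "\<lambda>S. mfps_subst (factor_monom R S) (factor_series (card S)) :: (gf_var, 'k) mfps"
  let ?O = "{S. S \<subseteq> A \<and> odd (card S)}" and ?E = "{S. S \<subseteq> A \<and> even (card S)}"
  let ?y = "\<lambda>S. (\<Prod>j\<in>S. u j) * (\<Prod>i\<in>#R. t i) * v :: (gf_var, 'k) mfps"
  have "(\<Prod>S\<in>?E. 1 - ?y S) * (\<Prod>S\<in>?E. ?g S) = 1"
    unfolding prod.distrib[symmetric]
  proof (rule prod.neutral, clarify)
    fix S :: "nat set" assume "even (card S)"
    have inv: "(1 - fps_X) * inverse (1 - fps_X) = (1 :: 'k fps)"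
      by (rule inverse_mult_eq_1') simp
    have "1 - ?y S = mfps_subst (factor_monom R S) (1 - fps_X)"
      by (simp add: mfps_subst_diff mfps_subst_1 mfps_subst_X mfps_monom_factor_monom)
    with \<open>even (card S)\<close> inv show "(1 - ?y S) * ?g S = 1"
      by (simp add: mfps_subst_mult[symmetric] factor_series_def mfps_subst_1)
  qed
  then have "inverse (\<Prod>S\<in>?E. 1 - ?y S) = (\<Prod>S\<in>?E. ?g S)"
    by (rule mfps_inverse_eq)
  moreover have "(\<Prod>S\<in>?O. 1 + ?y S) = (\<Prod>S\<in>?O. ?g S)"
    by (intro prod.cong refl)
      (simp add: mfps_subst_add mfps_subst_1 mfps_subst_X mfps_monom_factor_monom factor_series_def)
  moreover have "(\<Prod>S\<in>Pow A. ?g S) = (\<Prod>S\<in>?O. ?g S) * (\<Prod>S\<in>?E. ?g S)"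
    using assms by (subst prod.union_disjoint[symmetric]) (auto intro!: prod.cong)
  ultimately show ?thesis by (simp add: divide_mfps_def)
qed

text \<open>
  The exponent of \<open>v\<close> is \<open>k\<close>, and then the other exponents determine \<open>R\<close> and \<open>S\<close>.
\<close>
lemma mono_pow_factor_monom_inject:
  assumes "mono_pow (factor_monom R S) k = mono_pow (factor_monom R' S') k'"
    and "finite S" "finite S'" "k \<noteq> 0"
  shows "R = R' \<and> S = S'"
proof -
  have eq: "k * Poly_Mapping.lookup (factor_monom R S) z = k' * Poly_Mapping.lookup (factor_monom R' S') z" for z
    using arg_cong[OF assms(1), of "\<lambda>a. Poly_Mapping.lookup a z"] by simp
  from eq[of V] have "k' = k" by (simp add: lookup_factor_monom)
  with eq assms(4) have *: "Poly_Mapping.lookup (factor_monom R S) z = Poly_Mapping.lookup (factor_monom R' S') z" for z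
    by (metis mult_left_cancel)
  have "R = R'"
    using *[of "T i" for i] by (intro multiset_eqI) (simp add: lookup_factor_monom)
  moreover have "j \<in> S \<longleftrightarrow> j \<in> S'" for j
    using *[of "U j"] assms(2,3) by (simp add: lookup_factor_monom split: if_splits)
  ultimately show ?thesis by blast
qed

lemma fps_nth_inverse_1_minus_X_power:
  assumes "0 < n"
  shows "fps_nth (inverse (1 - fps_X ^ n) :: 'k::field fps) k = (if n dvd k then 1 else 0)"
proof -
  define f :: "'k fps" where "f = Abs_fps (\<lambda>k. if n dvd k then 1 else 0)"
  have "f * (1 - fps_X ^ n) = 1"
  proof (rule fps_ext)
    fix k show "fps_nth (f * (1 - fps_X ^ n)) k = fps_nth 1 k"
      using assms by (auto simp: right_diff_distrib fps_X_power_mult_right_nth f_def dvd_minus_self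
          dest: dvd_imp_le)
  qed
  then have "inverse (1 - fps_X ^ n) = f"
    by (metis fps_inverse_unique mult.commute)
  then show ?thesis by (simp add: f_def)
qed

lemma fps_nth_1_minus_minus_X_power:
  assumes "0 < n"
  shows "fps_nth (1 - (- fps_X) ^ n :: 'k::field fps) k =
    (if k = 0 then 1 else if k = n then (- 1) ^ Suc n else 0)"
proof -
  have "(- fps_X) ^ n = fps_const ((- 1) ^ n) * (fps_X ^ n :: 'k fps)"
    by (metis fps_const_1_eq_1 fps_const_neg fps_const_power power_minus)
  then show ?thesis
    using assms by (simp only: fps_sub_nth fps_mult_left_const_nth fps_X_power_nth) simp
qed

text \<open>
  At \<open>(u\<^sup>S t\<^sup>R v)\<^sup>n\<close> each \<open>j \<in> S\<close> contributes the top coefficient \<open>-(-1)\<^sup>n\<close> of \<open>1 - (-u\<^sub>j)\<^sup>n\<close>, and every other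
  variable contributes 1.
\<close>
lemma mfps_coeff_weight_gf_mono_pow:
  assumes R: "set_mset R \<subseteq> {1..l}" and S: "S \<subseteq> {1..m}" and n: "n \<noteq> 0"
  shows "mfps_coeff (weight_gf l m :: (gf_var, 'k::field) mfps) (mono_pow (factor_monom R S) n) =
    (- 1) ^ (card S * Suc n)"
proof -
  have fin: "finite S" using S finite_subset by blast
  have "Poly_Mapping.keys (mono_pow (factor_monom R S) n) \<subseteq> gf_vars l m"
    using R S fin by (auto simp: keys_subset_gf_vars lookup_factor_monom split: if_splits)
  moreover have "(\<Prod>j=1..m. fps_nth (1 - (- fps_X) ^ n) (n * (if j \<in> S then 1 else 0)) :: 'k) =
      (- 1) ^ (card S * Suc n)"
  proof -
    have "(\<Prod>j=1..m. fps_nth (1 - (- fps_X) ^ n) (n * (if j \<in> S then 1 else 0)) :: 'k) =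
        (\<Prod>j\<in>S. (- 1) ^ Suc n)"
      using S n by (intro prod.mono_neutral_cong_right)
        (auto simp: fps_nth_1_minus_minus_X_power simp del: fps_sub_nth)
    then show ?thesis by (simp only: prod_constant power_mult[symmetric] mult.commute)
  qed
  ultimately show ?thesis
    using n by (simp add: mfps_coeff_weight_gf lookup_factor_monom fin mfps_coeff_cycle_weight
        prod_gf_vars cycle_series_def fps_nth_inverse_1_minus_X_power fps_X_power_nth
        del: fps_sub_nth)
qed

text \<open>
  A monomial that occurs in \<open>cycle_weight l m n\<close> has exponents divisible by \<open>n\<close> at the \<open>t\<^sub>i\<close>, whose quotients form \<open>R\<close>,
  and exponents 0 or \<open>n\<close> at the \<open>u\<^sub>j\<close>, the latter forming \<open>S\<close>.
\<close>
lemma weight_gf_support: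
  assumes nz: "mfps_coeff (weight_gf l m :: (gf_var, 'k::field) mfps) b \<noteq> 0"
  obtains R S n where "set_mset R \<subseteq> {1..l}" "S \<subseteq> {1..m}" "n \<noteq> 0" "b = mono_pow (factor_monom R S) n"
proof -
  define n where "n = Poly_Mapping.lookup b V"
  from nz have n: "n \<noteq> 0" by (auto simp: mfps_coeff_weight_gf n_def split: if_splits)
  from nz n have keys: "Poly_Mapping.keys b \<subseteq> gf_vars l m"
    and prod: "(\<Prod>z\<in>gf_vars l m. fps_nth (cycle_series n z) (Poly_Mapping.lookup b z)) \<noteq> (0::'k)"
    by (auto simp: mfps_coeff_weight_gf n_def mfps_coeff_cycle_weight split: if_splits)
  have factor: "fps_nth (cycle_series n z) (Poly_Mapping.lookup b z) \<noteq> (0 :: 'k)"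
    if "z \<in> gf_vars l m" for z
    using prod that by auto
  have t: "n dvd Poly_Mapping.lookup b (T i)" if "i \<in> {1..l}" for i
    using factor[of "T i"] that n
    by (auto simp: gf_vars_def cycle_series_def fps_nth_inverse_1_minus_X_power split: if_splits)
  have u: "Poly_Mapping.lookup b (U j) \<in> {0, n}" if "j \<in> {1..m}" for j
    using factor[of "U j"] that n
    by (auto simp: gf_vars_def cycle_series_def fps_nth_1_minus_minus_X_power
        simp del: fps_sub_nth split: if_splits)
  define R where "R = (\<Sum>i=1..l. replicate_mset (Poly_Mapping.lookup b (T i) div n) i)"
  define S where "S = {j \<in> {1..m}. Poly_Mapping.lookup b (U j) = n}"
  have count: "count R i = (if i \<in> {1..l} then Poly_Mapping.lookup b (T i) div n else 0)" for i
    by (simp add: R_def count_sum)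
  show ?thesis
  proof
    show "set_mset R \<subseteq> {1..l}"
      using count by (auto simp: set_mset_def split: if_splits)
    show "S \<subseteq> {1..m}" by (auto simp: S_def)
    show "b = mono_pow (factor_monom R S) n"
    proof (rule gf_monom_eqI)
      fix i show "Poly_Mapping.lookup b (T i) = Poly_Mapping.lookup (mono_pow (factor_monom R S) n) (T i)"
        using keys t[of i] by (auto simp: keys_subset_gf_vars lookup_factor_monom count)
    next
      fix j show "Poly_Mapping.lookup b (U j) = Poly_Mapping.lookup (mono_pow (factor_monom R S) n) (U j)"
        using keys u[of j] n by (auto simp: keys_subset_gf_vars lookup_factor_monom S_def)
    qed (simp add: lookup_factor_monom n_def)
  qed (rule n)
qed

text \<open>
  At most one pair \<open>(R, S)\<close> contributes to a given coefficient, which is therefore constant once \<open>X\<close>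
  contains that \<open>R\<close>.
\<close>
lemma tendsto_weight_gf:
  "((\<lambda>X. \<Sum>R\<in>X. \<Sum>S\<in>Pow {1..m}. mfps_subst (factor_monom R S) (factor_log_series (card S)))
    \<longlongrightarrow> (weight_gf l m :: (gf_var, 'k::field) mfps))
    (finite_subsets_at_top {R :: nat multiset. set_mset R \<subseteq> {1..l}})"
  unfolding tendsto_mfps_iff
proof
  fix b
  let ?A = "{R :: nat multiset. set_mset R \<subseteq> {1..l}}"
  let ?c = "\<lambda>R S. mfps_coeff (mfps_subst (factor_monom R S) (factor_log_series (card S)) :: (gf_var, 'k) mfps) b"
  have nz: "\<exists>k. k \<noteq> 0 \<and> b = mono_pow (factor_monom R S) k" if "?c R S \<noteq> 0" for R S
  proof -
    from that obtain k where k: "b = mono_pow (factor_monom R S) k"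
      by (metis mfps_coeff_subst_eq_0)
    with that have "fps_nth (factor_log_series (card S) :: 'k fps) k \<noteq> 0"
      by (simp add: mfps_coeff_subst_mono_pow del: mono_pow_0)
    then have "k \<noteq> 0" by (auto simp: factor_log_series_def split: if_splits)
    with k show ?thesis by blast
  qed
  have "\<exists>X0. finite X0 \<and> X0 \<subseteq> ?A \<and> (\<forall>X. finite X \<and> X0 \<subseteq> X \<and> X \<subseteq> ?A \<longrightarrow>
      (\<Sum>R\<in>X. \<Sum>S\<in>Pow {1..m}. ?c R S) = mfps_coeff (weight_gf l m) b)"
  proof (cases "\<exists>R\<in>?A. \<exists>S\<in>Pow {1..m}. \<exists>n. n \<noteq> 0 \<and> b = mono_pow (factor_monom R S) n")
    case True
    then obtain R S n where RS: "R \<in> ?A" "S \<in> Pow {1..m}" and n: "n \<noteq> 0"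
      and b: "b = mono_pow (factor_monom R S) n" by blast
    have zero: "?c R' S' = 0" if "S' \<in> Pow {1..m}" "(R', S') \<noteq> (R, S)" for R' S'
    proof (rule ccontr)
      assume "?c R' S' \<noteq> 0"
      then obtain k where "b = mono_pow (factor_monom R' S') k" by (metis nz)
      with b n RS(2) that show False
        using mono_pow_factor_monom_inject[of R S n R' S' k]
        by (metis Pow_iff finite_atLeastAtMost finite_subset)
    qed
    have "(\<Sum>R\<in>X. \<Sum>S\<in>Pow {1..m}. ?c R S) = mfps_coeff (weight_gf l m) b"
      if X: "finite X" "{R} \<subseteq> X" "X \<subseteq> ?A" for X
    proof -
      have "(\<Sum>R\<in>X. \<Sum>S\<in>Pow {1..m}. ?c R S) = (\<Sum>R\<in>{R}. \<Sum>S\<in>Pow {1..m}. ?c R S)"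
        using X zero by (intro sum.mono_neutral_right) (auto intro!: sum.neutral)
      also have "\<dots> = (\<Sum>S\<in>Pow {1..m}. ?c R S)" by simp
      also have "\<dots> = (\<Sum>S\<in>{S}. ?c R S)"
        using RS zero by (intro sum.mono_neutral_right) auto
      also have "\<dots> = mfps_coeff (weight_gf l m) b"
        unfolding b using RS n
        by (simp add: mfps_coeff_weight_gf_mono_pow mfps_coeff_subst_mono_pow factor_log_series_def
            del: mult_Suc_right)
      finally show ?thesis .
    qed
    with RS show ?thesis by (intro exI[of _ "{R}"]) auto
  next
    case False
    then have "mfps_coeff (weight_gf l m :: (gf_var, 'k) mfps) b = 0"
      using weight_gf_support[of l m b] by (metis (mono_tags, lifting) Pow_iff mem_Collect_eq)
    moreover have "(\<Sum>R\<in>X. \<Sum>S\<in>Pow {1..m}. ?c R S) = 0" if "X \<subseteq> ?A" for X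
    proof (intro sum.neutral ballI)
      fix R S assume "R \<in> X" "S \<in> Pow {1..m}"
      with that False show "?c R S = 0" using nz[of R S] by blast
    qed
    ultimately show ?thesis by (intro exI[of _ "{}"]) auto
  qed
  then show "\<forall>\<^sub>F X in finite_subsets_at_top ?A. mfps_coeff (\<Sum>R\<in>X. \<Sum>S\<in>Pow {1..m}.
      mfps_subst (factor_monom R S) (factor_log_series (card S))) b = mfps_coeff (weight_gf l m :: (gf_var, 'k) mfps) b"
    by (simp add: eventually_finite_subsets_at_top mfps_coeff_sum)
qed

lemma has_prod_cycle_gf:
  "has_prod_over (\<lambda>R. \<Prod>S\<in>Pow {1..m}. mfps_subst (factor_monom R S) (factor_series (card S)))
    {R :: nat multiset. set_mset R \<subseteq> {1..l}} (cycle_gf l m :: (gf_var, 'k::field_char_0) mfps)"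
  unfolding has_prod_over_def
proof (rule tendsto_if_log_euler_tendsto[OF _ has_log_euler_cycle_gf tendsto_weight_gf])
  fix X :: "nat multiset set"
  show "has_log_euler V (\<Prod>R\<in>X. \<Prod>S\<in>Pow {1..m}. mfps_subst (factor_monom R S) (factor_series (card S)))
    (\<Sum>R\<in>X. \<Sum>S\<in>Pow {1..m}. mfps_subst (factor_monom R S) (factor_log_series (card S)) :: (gf_var, 'k) mfps)"
    by (intro has_log_euler_prod has_log_euler_subst lookup_factor_monom factor_log_series)
      (simp add: factor_series_def)
qed

theorem theorem4p1:
  fixes l m :: nat
  shows "\<exists>F :: (gf_var, 'k::field_char_0) mfps.
    ((\<lambda>(n, lam, mu).
        mfps_const (cp_avg n ((\<Prod>i=1..l. H (lam i)) * (\<Prod>j=1..m. E (mu j))))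
        * (\<Prod>i=1..l. t i ^ lam i) * (\<Prod>j=1..m. u j ^ mu j) * v ^ n) has_sum F)
      ((UNIV :: nat set) \<times> ({1..l} \<rightarrow>\<^sub>E (UNIV :: nat set)) \<times> ({1..m} \<rightarrow>\<^sub>E (UNIV :: nat set)))
    \<and> has_prod_over (\<lambda>R.
        (\<Prod>S | S \<subseteq> {1..m} \<and> odd (card S). 1 + (\<Prod>j\<in>S. u j) * (\<Prod>i\<in>#R. t i) * v)
        / (\<Prod>S | S \<subseteq> {1..m} \<and> even (card S). 1 - (\<Prod>j\<in>S. u j) * (\<Prod>i\<in>#R. t i) * v))
      {R :: nat multiset. set_mset R \<subseteq> {1..l}} F"
  unfolding factor_eq[OF finite_atLeastAtMost]
  using has_sum_cycle_gf has_prod_cycle_gf by blast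

end
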